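(* Let $k$ be an algebraically closed field, let $V$ and $W$ be irreducible affine algebraic varieties over $k$, and let $u : V \rightarrow W$ be a finite dominant morphism. Let $n = [k(V):k(W)]_{s}$ be the separable degree and assume that $W$ is normal. Then for every integer $m$ with $1 \leq m \leq n$, the set $F_{m} = \{ y \in W : |u^{-1}(y)| = m \}$ is a locally closed subset of $W$.
   Context: Varieties are classical algebraic varieties over $k$ with the Zariski topology; $|A|$ is the number of elements of a set $A$. $k(V)$, $k(W)$ are the function fields, with $k(W)$ embedded in $k(V)$ by $f\mapsto f\circ u$, and $[k(V):k(W)]_s$ is the separable degree of this extension. A subset is locally closed if it is the intersection of an open set and a closed set. *)

theory Defs
  imports
    "HOL-Analysis.Abstract_Topology"
    "HOL-Algebra.Finite_Extensions"
    "HOL-Computational_Algebra.Polynomial"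
begin

hide_const (open) Polynomial.degree Polynomial.lead_coeff Polynomial.coeff Polynomial.monom

section \<open>Fraction fields, integral closure, and separable degree\<close>

definition frac_rel :: "('a, 'b) ring_scheme \<Rightarrow> (('a \<times> 'a) \<times> ('a \<times> 'a)) set" where
  "frac_rel R = {((a, b), (c, d)).
     a \<in> carrier R \<and> b \<in> carrier R - {\<zero>\<^bsub>R\<^esub>} \<and> c \<in> carrier R \<and> d \<in> carrier R - {\<zero>\<^bsub>R\<^esub>} \<and>
     a \<otimes>\<^bsub>R\<^esub> d = c \<otimes>\<^bsub>R\<^esub> b}"

definition frac :: "('a, 'b) ring_scheme \<Rightarrow> 'a \<Rightarrow> 'a \<Rightarrow> ('a \<times> 'a) set" where
  "frac R a b = frac_rel R `` {(a, b)}"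

text \<open>Meaningful when \<open>R\<close> is an integral domain.\<close>

definition fraction_field :: "('a, 'b) ring_scheme \<Rightarrow> ('a \<times> 'a) set ring" where
  "fraction_field R = \<lparr>
     carrier = (carrier R \<times> (carrier R - {\<zero>\<^bsub>R\<^esub>})) // frac_rel R,
     mult = (\<lambda>P Q. \<Union>(a, b)\<in>P. \<Union>(c, d)\<in>Q. frac R (a \<otimes>\<^bsub>R\<^esub> c) (b \<otimes>\<^bsub>R\<^esub> d)),
     one = frac R \<one>\<^bsub>R\<^esub> \<one>\<^bsub>R\<^esub>,
     zero = frac R \<zero>\<^bsub>R\<^esub> \<one>\<^bsub>R\<^esub>,
     add = (\<lambda>P Q. \<Union>(a, b)\<in>P. \<Union>(c, d)\<in>Q.
              frac R ((a \<otimes>\<^bsub>R\<^esub> d) \<oplus>\<^bsub>R\<^esub> (c \<otimes>\<^bsub>R\<^esub> b)) (b \<otimes>\<^bsub>R\<^esub> d)) \<rparr>"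

definition frac_incl :: "('a, 'b) ring_scheme \<Rightarrow> 'a \<Rightarrow> ('a \<times> 'a) set" where
  "frac_incl R a = frac R a \<one>\<^bsub>R\<^esub>"

text \<open>The map \<open>a/b \<mapsto> h a / h b\<close> into the fraction field of \<open>S\<close> induced by an injective ring
  homomorphism \<open>h\<close> into \<open>S\<close>.\<close>

definition frac_map :: "('c, 'd) ring_scheme \<Rightarrow> ('a \<Rightarrow> 'c) \<Rightarrow> ('a \<times> 'a) set \<Rightarrow> ('c \<times> 'c) set" where
  "frac_map S h P = (\<Union>(a, b)\<in>P. frac S (h a) (h b))"

definition integral_over :: "('a, 'b) ring_scheme \<Rightarrow> 'a set \<Rightarrow> 'a \<Rightarrow> bool" where
  "integral_over L A x \<longleftrightarrow>
     (\<exists>p \<in> carrier (A[X]\<^bsub>L\<^esub>). p \<noteq> [] \<and> lead_coeff p = \<one>\<^bsub>L\<^esub> \<and> ring.eval L p x = \<zero>\<^bsub>L\<^esub>)"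

definition integrally_closed :: "('a, 'b) ring_scheme \<Rightarrow> bool" where
  "integrally_closed R \<longleftrightarrow>
     (\<forall>x \<in> carrier (fraction_field R).
        integral_over (fraction_field R) (frac_incl R ` carrier R) x \<longrightarrow>
        x \<in> frac_incl R ` carrier R)"

text \<open>Coefficient lists have the leading coefficient first, hence the reversed index list.\<close>

definition formal_deriv :: "('a, 'b) ring_scheme \<Rightarrow> 'a list \<Rightarrow> 'a list" where
  "formal_deriv L p =
     ring.normalize L (map (\<lambda>i. [i] \<cdot>\<^bsub>L\<^esub> ring.coeff L p i) (rev [1..<length p]))"

text \<open>\<open>x\<close> is separable over the subfield \<open>F\<close> if it is algebraic and its minimal polynomial is
  coprime in \<open>F[X]\<close> to its derivative.\<close>

definition separable_over :: "('a, 'b) ring_scheme \<Rightarrow> 'a set \<Rightarrow> 'a \<Rightarrow> bool" where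
  "separable_over L F x \<longleftrightarrow>
     ring.algebraic L F x \<and>
     (\<forall>q \<in> carrier (F[X]\<^bsub>L\<^esub>).
        q divides\<^bsub>F[X]\<^bsub>L\<^esub>\<^esub> (ring.Irr L F x) \<and>
        q divides\<^bsub>F[X]\<^bsub>L\<^esub>\<^esub> (formal_deriv L (ring.Irr L F x)) \<longrightarrow>
        q \<in> Units (F[X]\<^bsub>L\<^esub>))"

text \<open>\<open>[L : F]\<^sub>s\<close>, the degree over \<open>F\<close> of the separable closure of \<open>F\<close> in \<open>L\<close>; meaningful when
  this degree is finite, in particular when \<open>L\<close> is a finite extension of \<open>F\<close>.\<close>

definition separable_degree :: "('a, 'b) ring_scheme \<Rightarrow> 'a set \<Rightarrow> nat" where
  "separable_degree L F = ring.dim L F {x \<in> carrier L. separable_over L F x}"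


section \<open>Affine varieties\<close>

text \<open>Points of \<open>k\<^sup>d\<close> are functions \<open>nat \<Rightarrow> 'k\<close> that are \<open>undefined\<close> outside \<open>{..<d}\<close>, so
  that \<open>d\<close> may be any natural number.\<close>

definition affine_space :: "nat \<Rightarrow> (nat \<Rightarrow> 'k) set" where
  "affine_space d = {..<d} \<rightarrow>\<^sub>E UNIV"

inductive_set polyfuns :: "nat \<Rightarrow> ((nat \<Rightarrow> 'k::comm_ring_1) \<Rightarrow> 'k) set" for d :: nat where
  const: "(\<lambda>_. c) \<in> polyfuns d"
| coord: "i < d \<Longrightarrow> (\<lambda>x. x i) \<in> polyfuns d"
| add: "f \<in> polyfuns d \<Longrightarrow> g \<in> polyfuns d \<Longrightarrow> (\<lambda>x. f x + g x) \<in> polyfuns d"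
| mult: "f \<in> polyfuns d \<Longrightarrow> g \<in> polyfuns d \<Longrightarrow> (\<lambda>x. f x * g x) \<in> polyfuns d"

definition zero_locus :: "nat \<Rightarrow> ((nat \<Rightarrow> 'k::comm_ring_1) \<Rightarrow> 'k) set \<Rightarrow> (nat \<Rightarrow> 'k) set" where
  "zero_locus d S = {x \<in> affine_space d. \<forall>f\<in>S. f x = 0}"

definition zariski :: "nat \<Rightarrow> (nat \<Rightarrow> 'k::idom) topology" where
  "zariski d = topology (\<lambda>U. \<exists>S \<subseteq> polyfuns d. U = affine_space d - zero_locus d S)"

lemma istopology_zariski:
  "istopology (\<lambda>U. \<exists>S \<subseteq> (polyfuns d :: ((nat \<Rightarrow> 'k::idom) \<Rightarrow> 'k) set).
                      U = affine_space d - zero_locus d S)"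
  unfolding istopology_def
proof (intro conjI allI impI)
  fix U1 U2 :: "(nat \<Rightarrow> 'k) set"
  assume "\<exists>S\<subseteq>polyfuns d. U1 = affine_space d - zero_locus d S"
  then obtain S where S: "S \<subseteq> polyfuns d" "U1 = affine_space d - zero_locus d S" by blast
  assume "\<exists>S\<subseteq>polyfuns d. U2 = affine_space d - zero_locus d S"
  then obtain T where T: "T \<subseteq> polyfuns d" "U2 = affine_space d - zero_locus d T" by blast
  define P where "P = {(\<lambda>x. f x * g x) | f g. f \<in> S \<and> g \<in> T}"
  have "P \<subseteq> polyfuns d"
    using S(1) T(1) by (auto simp: P_def intro: polyfuns.mult)
  moreover have "U1 \<inter> U2 = affine_space d - zero_locus d P"
  proof -
    have "x \<in> zero_locus d P \<longleftrightarrow> x \<in> zero_locus d S \<or> x \<in> zero_locus d T" for x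
    proof
      assume x: "x \<in> zero_locus d P"
      have prod: "f x * g x = 0" if "f \<in> S" "g \<in> T" for f g
      proof -
        have "(\<lambda>x. f x * g x) \<in> P" using that by (auto simp: P_def)
        moreover have "\<forall>h\<in>P. h x = 0" using x by (simp add: zero_locus_def)
        ultimately show ?thesis by (rule bspec[rotated])
      qed
      show "x \<in> zero_locus d S \<or> x \<in> zero_locus d T"
      proof (rule ccontr)
        assume "\<not> ?thesis"
        with x obtain f g where "f \<in> S" "f x \<noteq> 0" "g \<in> T" "g x \<noteq> 0"
          unfolding zero_locus_def by blast
        with prod show False by force
      qed
    next
      assume "x \<in> zero_locus d S \<or> x \<in> zero_locus d T"
      thus "x \<in> zero_locus d P" by (auto simp: P_def zero_locus_def)
    qed
    thus ?thesis unfolding S(2) T(2) by blast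
  qed
  ultimately show "\<exists>S\<subseteq>polyfuns d. U1 \<inter> U2 = affine_space d - zero_locus d S" by blast
next
  fix \<U> :: "(nat \<Rightarrow> 'k) set set"
  assume "\<forall>U\<in>\<U>. \<exists>S\<subseteq>polyfuns d. U = affine_space d - zero_locus d S"
  then obtain S where S: "\<And>U. U \<in> \<U> \<Longrightarrow> S U \<subseteq> polyfuns d"
      "\<And>U. U \<in> \<U> \<Longrightarrow> U = affine_space d - zero_locus d (S U)"
    by metis
  have "\<Union>\<U> = (\<Union>U\<in>\<U>. affine_space d - zero_locus d (S U))"
    using S(2) by auto
  also have "\<dots> = affine_space d - zero_locus d (\<Union>U\<in>\<U>. S U)"
    by (auto simp: zero_locus_def)
  finally have "\<Union>\<U> = affine_space d - zero_locus d (\<Union>U\<in>\<U>. S U)" .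
  moreover have "(\<Union>U\<in>\<U>. S U) \<subseteq> polyfuns d" using S(1) by blast
  ultimately show "\<exists>S\<subseteq>polyfuns d. \<Union>\<U> = affine_space d - zero_locus d S" by blast
qed

lemma openin_zariski:
  "openin (zariski d) U \<longleftrightarrow> (\<exists>S \<subseteq> polyfuns d. U = affine_space d - zero_locus d S)"
  unfolding zariski_def by (simp add: istopology_zariski topology_inverse')

lemma topspace_zariski: "topspace (zariski d) = (affine_space d :: (nat \<Rightarrow> 'k::idom) set)"
proof -
  have "openin (zariski d) (affine_space d :: (nat \<Rightarrow> 'k) set)"
    unfolding openin_zariski
    by (rule exI[of _ "{\<lambda>_. 1}"]) (auto simp: zero_locus_def intro: polyfuns.const)
  thus ?thesis
    by (metis Diff_subset openin_subset openin_topspace openin_zariski subset_antisym)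
qed

lemma closedin_zariski:
  "closedin (zariski d) V \<longleftrightarrow> (\<exists>S \<subseteq> polyfuns d. V = zero_locus d S)"
proof -
  have "zero_locus d S \<subseteq> affine_space d" for S :: "((nat \<Rightarrow> 'a) \<Rightarrow> 'a) set"
    by (auto simp: zero_locus_def)
  thus ?thesis
    unfolding closedin_def topspace_zariski openin_zariski by (metis double_diff order_refl)
qed

definition irreducible_space :: "'a topology \<Rightarrow> bool" where
  "irreducible_space T \<longleftrightarrow> topspace T \<noteq> {} \<and>
     (\<forall>A B. closedin T A \<and> closedin T B \<and> A \<union> B = topspace T \<longrightarrow>
        A = topspace T \<or> B = topspace T)"

definition locally_closedin :: "'a topology \<Rightarrow> 'a set \<Rightarrow> bool" where
  "locally_closedin T S \<longleftrightarrow> (\<exists>U C. openin T U \<and> closedin T C \<and> S = U \<inter> C)"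

definition irreducible_affine_variety :: "nat \<Rightarrow> (nat \<Rightarrow> 'k::idom) set \<Rightarrow> bool" where
  "irreducible_affine_variety d V \<longleftrightarrow>
     closedin (zariski d) V \<and> irreducible_space (subtopology (zariski d) V)"

text \<open>The elements of \<open>k[V]\<close> are extensional functions, so equality in \<open>k[V]\<close> is equality on \<open>V\<close>.\<close>

definition coordinate_ring ::
  "nat \<Rightarrow> (nat \<Rightarrow> 'k::comm_ring_1) set \<Rightarrow> ((nat \<Rightarrow> 'k) \<Rightarrow> 'k) ring" where
  "coordinate_ring d V = \<lparr>
     carrier = (\<lambda>f. restrict f V) ` polyfuns d,
     mult = (\<lambda>f g. \<lambda>x\<in>V. f x * g x),
     one = (\<lambda>x\<in>V. 1),
     zero = (\<lambda>x\<in>V. 0),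
     add = (\<lambda>f g. \<lambda>x\<in>V. f x + g x) \<rparr>"

abbreviation function_field ::
  "nat \<Rightarrow> (nat \<Rightarrow> 'k::comm_ring_1) set \<Rightarrow> (((nat \<Rightarrow> 'k) \<Rightarrow> 'k) \<times> ((nat \<Rightarrow> 'k) \<Rightarrow> 'k)) set ring" where
  "function_field d V \<equiv> fraction_field (coordinate_ring d V)"

definition normal_variety :: "nat \<Rightarrow> (nat \<Rightarrow> 'k::idom) set \<Rightarrow> bool" where
  "normal_variety d V \<longleftrightarrow> integrally_closed (coordinate_ring d V)"


section \<open>Morphisms of affine varieties\<close>

definition variety_morphism ::
  "nat \<Rightarrow> (nat \<Rightarrow> 'k::idom) set \<Rightarrow> nat \<Rightarrow> (nat \<Rightarrow> 'k) set \<Rightarrow> ((nat \<Rightarrow> 'k) \<Rightarrow> (nat \<Rightarrow> 'k)) \<Rightarrow> bool" where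
  "variety_morphism d V e W u \<longleftrightarrow>
     u \<in> V \<rightarrow> W \<and> (\<forall>i<e. (\<lambda>x\<in>V. u x i) \<in> carrier (coordinate_ring d V))"

definition dominant ::
  "(nat \<Rightarrow> 'k::idom) set \<Rightarrow> nat \<Rightarrow> (nat \<Rightarrow> 'k) set \<Rightarrow> ((nat \<Rightarrow> 'k) \<Rightarrow> (nat \<Rightarrow> 'k)) \<Rightarrow> bool" where
  "dominant V e W u \<longleftrightarrow> subtopology (zariski e) W closure_of (u ` V) = W"

definition comorphism ::
  "(nat \<Rightarrow> 'k) set \<Rightarrow> ((nat \<Rightarrow> 'k) \<Rightarrow> (nat \<Rightarrow> 'k)) \<Rightarrow> ((nat \<Rightarrow> 'k) \<Rightarrow> 'k) \<Rightarrow> ((nat \<Rightarrow> 'k) \<Rightarrow> 'k)" where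
  "comorphism V u f = compose V f u"

text \<open>\<open>u\<close> is finite if \<open>k[V]\<close> is a finitely generated module over (the image of) \<open>k[W]\<close>.\<close>

definition finite_morphism ::
  "nat \<Rightarrow> (nat \<Rightarrow> 'k::idom) set \<Rightarrow> nat \<Rightarrow> (nat \<Rightarrow> 'k) set \<Rightarrow> ((nat \<Rightarrow> 'k) \<Rightarrow> (nat \<Rightarrow> 'k)) \<Rightarrow> bool" where
  "finite_morphism d V e W u \<longleftrightarrow>
     variety_morphism d V e W u \<and>
     (\<exists>gs. set gs \<subseteq> carrier (coordinate_ring d V) \<and>
        ring.Span (coordinate_ring d V) (comorphism V u ` carrier (coordinate_ring e W)) gs
          = carrier (coordinate_ring d V))"

text \<open>The image of \<open>k(W)\<close> in \<open>k(V)\<close> under \<open>f \<mapsto> f \<circ> u\<close>, for dominant \<open>u\<close>.\<close>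

definition embedded_function_field ::
  "nat \<Rightarrow> (nat \<Rightarrow> 'k::idom) set \<Rightarrow> nat \<Rightarrow> (nat \<Rightarrow> 'k) set \<Rightarrow> ((nat \<Rightarrow> 'k) \<Rightarrow> (nat \<Rightarrow> 'k)) \<Rightarrow>
     (((nat \<Rightarrow> 'k) \<Rightarrow> 'k) \<times> ((nat \<Rightarrow> 'k) \<Rightarrow> 'k)) set set" where
  "embedded_function_field d V e W u =
     frac_map (coordinate_ring d V) (comorphism V u) ` carrier (function_field e W)"

end

theory Submission
  imports Defs "Jordan_Normal_Form.Char_Poly"
begin

text \<open>The set of points \<open>y\<close> of \<open>W\<close> whose fibre has at least \<open>m\<close> points is open for every \<open>m\<close>; the set
  \<open>F\<^sub>m\<close> is the difference of two such sets. This openness comes from the normality of \<open>W\<close>.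

  Suppose that the fibre over \<open>y\<^sub>0\<close> contains \<open>m\<close> distinct points, and choose a regular function \<open>f\<close> on
  \<open>V\<close> with distinct values there. It is integral over \<open>k[W]\<close>, and since \<open>W\<close> is normal its minimal
  polynomial \<open>P\<close> over \<open>k(W)\<close> has coefficients in \<open>k[W]\<close> (\<open>minimal_polynomial\<close>). Specialising the
  coefficients at \<open>y\<close> gives a monic polynomial \<open>P\<^sub>y\<close> over \<open>k\<close>, whose degree does not depend on \<open>y\<close>.
  The values of \<open>f\<close> on the fibre over \<open>y\<close> are roots of \<open>P\<^sub>y\<close>, so \<open>P\<close> has at least \<open>m\<close> distinct roots at
  \<open>y\<^sub>0\<close>, and then also at all points of a neighbourhood of \<open>y\<^sub>0\<close> (\<open>many_roots_open\<close>). Conversely every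
  root of \<open>P\<^sub>y\<close> is the value of \<open>f\<close> at a point of the fibre over \<open>y\<close> (\<open>root_is_value\<close>), so the fibres
  over this neighbourhood have at least \<open>m\<close> points.

  The last two facts both follow from \<open>finite_image_closed\<close>: a finite map from an affine variety has
  closed image. It is applied to the map \<open>(u, f)\<close> from \<open>V\<close> to \<open>W \<times> k\<close>, and to the map that forgets the
  tuple of roots of \<open>P\<^sub>y\<close>. All integrality statements rest on \<open>determinant_trick\<close>, and the regularity
  of integral quotients on \<open>normal_variety_dvd\<close>.\<close>

section \<open>Algebras of functions and families of polynomials\<close>

text \<open>Subalgebras of the algebra of all functions on a type. Regular functions are treated as
  elements of such an algebra, so that identities between them can be checked pointwise.\<close>

locale fun_algebra =
  fixes R :: "('z \<Rightarrow> 'k::comm_ring_1) set"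
  assumes const: "(\<lambda>_. c) \<in> R"
    and add: "f \<in> R \<Longrightarrow> g \<in> R \<Longrightarrow> (\<lambda>z. f z + g z) \<in> R"
    and mult: "f \<in> R \<Longrightarrow> g \<in> R \<Longrightarrow> (\<lambda>z. f z * g z) \<in> R"
begin

lemma uminus: "f \<in> R \<Longrightarrow> (\<lambda>z. - f z) \<in> R"
  using mult[OF const[of "-1"], of f] by simp

lemma diff: "f \<in> R \<Longrightarrow> g \<in> R \<Longrightarrow> (\<lambda>z. f z - g z) \<in> R"
  using add[OF _ uminus, of f g] by simp

lemma sum: "(\<And>i. i \<in> I \<Longrightarrow> f i \<in> R) \<Longrightarrow> (\<lambda>z. \<Sum>i\<in>I. f i z) \<in> R"
  by (induction I rule: infinite_finite_induct) (auto intro: const add)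

lemma prod: "(\<And>i. i \<in> I \<Longrightarrow> f i \<in> R) \<Longrightarrow> (\<lambda>z. \<Prod>i\<in>I. f i z) \<in> R"
  by (induction I rule: infinite_finite_induct) (auto intro: const mult)

lemma power: "f \<in> R \<Longrightarrow> (\<lambda>z. f z ^ n) \<in> R"
  by (induction n) (auto intro: const mult)

end

lemma fun_algebra_polyfuns: "fun_algebra (polyfuns d)"
  by unfold_locales (auto intro: polyfuns.intros)

text \<open>A polynomial with coefficients in a set \<open>R\<close> of functions, seen as a family of polynomials over the
  ground ring: the value at \<open>z\<close> is obtained by evaluating all coefficients at \<open>z\<close>. The degrees of
  the values are bounded but may vary.\<close>

definition poly_family :: "('z \<Rightarrow> 'k::comm_ring_1) set \<Rightarrow> ('z \<Rightarrow> 'k poly) set" where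
  "poly_family R = {F. (\<forall>i. (\<lambda>z. Polynomial.coeff (F z) i) \<in> R) \<and> (\<exists>n. \<forall>z. Polynomial.degree (F z) \<le> n)}"

context fun_algebra
begin

lemma family_coeff: "F \<in> poly_family R \<Longrightarrow> (\<lambda>z. Polynomial.coeff (F z) i) \<in> R"
  by (simp add: poly_family_def)

lemma family_bound:
  assumes "F \<in> poly_family R"
  obtains n where "\<And>z. Polynomial.degree (F z) \<le> n"
  using assms by (auto simp: poly_family_def)

lemma family_eval:
  assumes F: "F \<in> poly_family R" and f: "f \<in> R"
  shows "(\<lambda>z. poly (F z) (f z)) \<in> R"
proof -
  obtain n where n: "\<And>z. Polynomial.degree (F z) \<le> n" using family_bound[OF F] by blast
  have "(\<lambda>z. \<Sum>i\<le>n. Polynomial.coeff (F z) i * f z ^ i) \<in> R"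
    by (intro sum mult power family_coeff F f)
  moreover have "poly (F z) (f z) = (\<Sum>i\<le>n. Polynomial.coeff (F z) i * f z ^ i)" for z
    unfolding poly_altdef by (rule sum.mono_neutral_left) (use n in \<open>auto intro: le_degree\<close>)
  ultimately show ?thesis by simp
qed

lemma family_const: "(\<lambda>_. p) \<in> poly_family R"
  by (auto simp: poly_family_def intro: const)

lemma family_monom: "f \<in> R \<Longrightarrow> (\<lambda>z. Polynomial.monom (f z) n) \<in> poly_family R"
proof -
  assume f: "f \<in> R"
  have "(\<lambda>z. Polynomial.coeff (Polynomial.monom (f z) n) i) \<in> R" for i
    by (cases "i = n") (use f const[of 0] in auto)
  thus ?thesis by (auto simp: poly_family_def intro: Polynomial.degree_monom_le)
qed

lemma family_pCons0: "f \<in> R \<Longrightarrow> (\<lambda>z. [:f z:]) \<in> poly_family R"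
  using family_monom[of f 0] by (simp add: monom_0)

lemma family_add:
  assumes F: "F \<in> poly_family R" and G: "G \<in> poly_family R"
  shows "(\<lambda>z. F z + G z) \<in> poly_family R"
proof -
  obtain n m where "\<And>z. Polynomial.degree (F z) \<le> n" "\<And>z. Polynomial.degree (G z) \<le> m"
    using family_bound F G by metis
  hence "\<forall>z. Polynomial.degree (F z + G z) \<le> max n m"
    by (meson degree_add_le max.coboundedI1 max.coboundedI2)
  thus ?thesis using add[OF family_coeff family_coeff, OF F G] by (auto simp: poly_family_def)
qed

lemma family_mult:
  assumes F: "F \<in> poly_family R" and G: "G \<in> poly_family R"
  shows "(\<lambda>z. F z * G z) \<in> poly_family R"
proof -
  obtain n m where "\<And>z. Polynomial.degree (F z) \<le> n" "\<And>z. Polynomial.degree (G z) \<le> m"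
    using family_bound F G by metis
  hence "\<forall>z. Polynomial.degree (F z * G z) \<le> n + m"
    by (meson Polynomial.degree_mult_le add_mono order_trans)
  moreover have "(\<lambda>z. Polynomial.coeff (F z * G z) i) \<in> R" for i
    unfolding coeff_mult by (intro sum mult family_coeff F G)
  ultimately show ?thesis by (auto simp: poly_family_def)
qed

lemma fun_algebra_family_eval:
  "fun_algebra {\<lambda>(z, t). poly (F z) t |F. F \<in> poly_family R}" (is "fun_algebra ?S")
proof
  show "(\<lambda>_. c) \<in> ?S" for c
    using family_const[of "[:c:]"] by force
next
  fix f g assume "f \<in> ?S" "g \<in> ?S"
  then obtain F G where F: "F \<in> poly_family R" "f = (\<lambda>(z, t). poly (F z) t)"
    and G: "G \<in> poly_family R" "g = (\<lambda>(z, t). poly (G z) t)" by blast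
  show "(\<lambda>z. f z + g z) \<in> ?S"
    by (rule CollectI, rule exI[of _ "\<lambda>z. F z + G z"]) (auto simp: F G intro!: family_add)
  show "(\<lambda>z. f z * g z) \<in> ?S"
    by (rule CollectI, rule exI[of _ "\<lambda>z. F z * G z"]) (auto simp: F G intro!: family_mult)
qed

lemma family_uminus: "F \<in> poly_family R \<Longrightarrow> (\<lambda>z. - F z) \<in> poly_family R"
  using family_mult[OF family_const[of "-1"], of F] by simp

lemma family_diff: "F \<in> poly_family R \<Longrightarrow> G \<in> poly_family R \<Longrightarrow> (\<lambda>z. F z - G z) \<in> poly_family R"
  using family_add[OF _ family_uminus, of F G] by simp

lemma family_sum: "(\<And>i. i \<in> I \<Longrightarrow> F i \<in> poly_family R) \<Longrightarrow> (\<lambda>z. \<Sum>i\<in>I. F i z) \<in> poly_family R"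
  by (induction I rule: infinite_finite_induct) (auto intro: family_const family_add)

lemma family_prod: "(\<And>i. i \<in> I \<Longrightarrow> F i \<in> poly_family R) \<Longrightarrow> (\<lambda>z. \<Prod>i\<in>I. F i z) \<in> poly_family R"
  by (induction I rule: infinite_finite_induct) (auto intro: family_const family_mult)

lemma family_linear: "f \<in> R \<Longrightarrow> (\<lambda>z. [:- f z, 1:]) \<in> poly_family R"
  using family_diff[OF family_const[of "[:0, 1:]"] family_pCons0, of f] by simp

end

text \<open>The characteristic polynomial of a matrix over \<open>R\<close> has coefficients in \<open>R\<close>. Its roots are the
  eigenvalues; this is how monic equations over \<open>R\<close> arise below.\<close>

lemma (in fun_algebra) char_poly_family:
  fixes \<beta> :: "nat \<Rightarrow> nat \<Rightarrow> 'z \<Rightarrow> 'k"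
  assumes "\<And>i j. i < n \<Longrightarrow> j < n \<Longrightarrow> \<beta> i j \<in> R"
  shows "(\<lambda>z. char_poly (mat n n (\<lambda>(i, j). \<beta> i j z))) \<in> poly_family R"
proof -
  have eq: "char_poly (mat n n (\<lambda>(i, j). \<beta> i j z)) =
      (\<Sum>p | p permutes {0..<n}. signof p *
        (\<Prod>i = 0..<n. (if i = p i then [:0, 1:] else 0) - [:\<beta> i (p i) z:]))" for z
  proof -
    have "char_poly (mat n n (\<lambda>(i, j). \<beta> i j z)) = (\<Sum>p | p permutes {0..<n}. signof p *
        (\<Prod>i = 0..<n. char_poly_matrix (mat n n (\<lambda>(i, j). \<beta> i j z)) $$ (i, p i)))"
      unfolding char_poly_def by (rule det_def') (auto simp: char_poly_matrix_def)
    also have "\<dots> = (\<Sum>p | p permutes {0..<n}. signof p *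
        (\<Prod>i = 0..<n. (if i = p i then [:0, 1:] else 0) - [:\<beta> i (p i) z:]))"
    proof (intro sum.cong refl arg_cong2[of _ _ _ _ "(*)"] prod.cong)
      fix p i assume p: "p \<in> {p. p permutes {0..<n}}" and i: "i \<in> {0..<n}"
      hence "p i < n" using permutes_in_image[of p "{0..<n}" i] by auto
      thus "char_poly_matrix (mat n n (\<lambda>(i, j). \<beta> i j z)) $$ (i, p i) =
          (if i = p i then [:0, 1:] else 0) - [:\<beta> i (p i) z:]"
        using i by (auto simp: char_poly_matrix_def)
    qed
    finally show ?thesis .
  qed
  show ?thesis unfolding eq
  proof (intro family_sum family_mult family_const family_prod family_diff family_pCons0)
    fix p i assume p: "p \<in> {p. p permutes {0..<n}}" and i: "i \<in> {0..<n}"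
    hence "p i < n" using permutes_in_image[of p "{0..<n}" i] by auto
    thus "\<beta> i (p i) \<in> R" using i assms by simp
  qed
qed

lemma poly_char_poly_eq_0:
  fixes v :: "nat \<Rightarrow> 'k::field"
  assumes v: "i < n" "v i \<noteq> 0"
    and ev: "\<And>i. i < n \<Longrightarrow> (\<Sum>j<n. b i j * v j) = c * v i"
  shows "poly (char_poly (mat n n (\<lambda>(i, j). b i j))) c = 0"
proof -
  let ?A = "mat n n (\<lambda>(i, j). b i j)"
  have "eigenvector ?A (vec n v) c"
    unfolding eigenvector_def
  proof (intro conjI)
    show "vec n v \<in> carrier_vec (dim_row ?A)" by simp
    show "vec n v \<noteq> 0\<^sub>v (dim_row ?A)"
      using v by (metis dim_row_mat(1) index_vec index_zero_vec(1))
    show "?A *\<^sub>v vec n v = c \<cdot>\<^sub>v vec n v"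
      by (rule eq_vecI) (use ev in \<open>auto simp: scalar_prod_def lessThan_atLeast0\<close>)
  qed
  hence "eigenvalue ?A c" unfolding eigenvalue_def by blast
  thus ?thesis using eigenvalue_root_char_poly[of ?A n c] by simp
qed

lemma char_poly_zero_mat:
  "char_poly (mat n n (\<lambda>_. 0 :: 'k::idom)) = [:0, 1:] ^ n"
proof -
  have "char_poly (mat n n (\<lambda>_. 0 :: 'k)) = (\<Prod>a\<leftarrow>diag_mat (mat n n (\<lambda>_. 0)). [:- a, 1:])"
    by (rule char_poly_upper_triangular) auto
  also have "diag_mat (mat n n (\<lambda>_. 0 :: 'k)) = replicate n 0"
    by (intro nth_equalityI) (auto simp: diag_mat_def)
  finally show ?thesis by (simp add: prod_list_replicate)
qed

section \<open>Finite extensions of algebras of functions\<close>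

text \<open>For \<open>h : Y \<rightarrow> Z\<close> and an algebra \<open>R\<close> of functions on \<open>Z\<close>, the functions on \<open>Y\<close> which are
  combinations of elements of \<open>S\<close> with coefficients in the set \<open>R\<close>, pulled back along \<open>h\<close>. Functions are
  total and only their values on \<open>Y\<close> matter. Taking for \<open>R\<close> an ideal of the algebra gives the
  corresponding submodule.\<close>

inductive_set rspan :: "('z \<Rightarrow> 'k::comm_ring_1) set \<Rightarrow> ('x \<Rightarrow> 'z) \<Rightarrow> 'x set \<Rightarrow> ('x \<Rightarrow> 'k) set \<Rightarrow> ('x \<Rightarrow> 'k) set"
  for R h Y S where
  zero: "(\<And>x. x \<in> Y \<Longrightarrow> \<phi> x = 0) \<Longrightarrow> \<phi> \<in> rspan R h Y S"
| step: "\<rho> \<in> R \<Longrightarrow> g \<in> S \<Longrightarrow> \<phi> \<in> rspan R h Y S \<Longrightarrow>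
    (\<And>x. x \<in> Y \<Longrightarrow> \<psi> x = \<rho> (h x) * g x + \<phi> x) \<Longrightarrow> \<psi> \<in> rspan R h Y S"

lemma rspan_cong: "\<phi> \<in> rspan R h Y S \<Longrightarrow> (\<And>x. x \<in> Y \<Longrightarrow> \<psi> x = \<phi> x) \<Longrightarrow> \<psi> \<in> rspan R h Y S"
  by (induction arbitrary: \<psi> rule: rspan.induct) (auto intro: rspan.intros)

lemma rspan_add:
  "\<phi> \<in> rspan R h Y S \<Longrightarrow> \<psi> \<in> rspan R h Y S \<Longrightarrow> (\<lambda>x. \<phi> x + \<psi> x) \<in> rspan R h Y S"
proof (induction rule: rspan.induct)
  case (zero \<phi>)
  thus ?case by (auto intro: rspan_cong[of \<psi>])
next
  case (step \<rho> g \<phi>1 \<phi>2)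
  show ?case by (rule rspan.step[OF step.hyps(1,2) step.IH[OF step.prems]]) (use step.hyps in simp)
qed

lemma rspan_mono: "R \<subseteq> R' \<Longrightarrow> S \<subseteq> S' \<Longrightarrow> rspan R h Y S \<subseteq> rspan R' h Y S'"
proof
  fix \<phi> assume RS: "R \<subseteq> R'" "S \<subseteq> S'" and "\<phi> \<in> rspan R h Y S"
  from this(3) show "\<phi> \<in> rspan R' h Y S'"
    by induction (use RS in \<open>auto intro: rspan.intros\<close>)
qed

lemma rspan_smult:
  assumes "\<And>\<rho>. \<rho> \<in> R \<Longrightarrow> (\<lambda>z. \<sigma> z * \<rho> z) \<in> I"
  shows "\<phi> \<in> rspan R h Y S \<Longrightarrow> (\<lambda>x. \<sigma> (h x) * \<phi> x) \<in> rspan I h Y S"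
proof (induction rule: rspan.induct)
  case (step \<rho> g \<phi>1 \<phi>2)
  show ?case
    by (rule rspan.step[OF assms[OF step.hyps(1)] step.hyps(2) step.IH])
       (use step.hyps in \<open>simp add: algebra_simps\<close>)
qed (auto intro: rspan.zero)

lemma rspan_repr:
  fixes n :: nat
  assumes "\<phi> \<in> rspan R h Y (g ` {..<n})" and R: "(\<lambda>_. 0) \<in> R" "\<And>\<rho> \<sigma>. \<rho> \<in> R \<Longrightarrow> \<sigma> \<in> R \<Longrightarrow> (\<lambda>z. \<rho> z + \<sigma> z) \<in> R"
  shows "\<exists>\<rho>. (\<forall>j<n. \<rho> j \<in> R) \<and> (\<forall>x\<in>Y. \<phi> x = (\<Sum>j<n. \<rho> j (h x) * g j x))"
  using assms(1)
proof (induction rule: rspan.induct)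
  case (zero \<phi>)
  show ?case by (rule exI[of _ "\<lambda>_ _. 0"]) (use R zero in auto)
next
  case (step \<rho> g' \<phi> \<psi>)
  from step.IH obtain \<sigma> where \<sigma>: "\<And>j. j < n \<Longrightarrow> \<sigma> j \<in> R"
      "\<And>x. x \<in> Y \<Longrightarrow> \<phi> x = (\<Sum>j<n. \<sigma> j (h x) * g j x)"
    by blast
  from step.hyps(2) obtain j where j: "j < n" "g' = g j" by auto
  show ?case
  proof (intro exI conjI ballI allI impI)
    show "(if i = j then (\<lambda>z. \<rho> z + \<sigma> j z) else \<sigma> i) \<in> R" if "i < n" for i
      using that \<sigma>(1) step.hyps R by auto
    fix x assume x: "x \<in> Y"
    have "\<psi> x = \<rho> (h x) * g j x + (\<Sum>i<n. \<sigma> i (h x) * g i x)"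
      using step.hyps(4)[OF x] \<sigma>(2)[OF x] j by simp
    also have "\<rho> (h x) * g j x = (\<Sum>i<n. if i = j then \<rho> (h x) * g j x else 0)"
      using j by simp
    also have "\<dots> + (\<Sum>i<n. \<sigma> i (h x) * g i x) =
        (\<Sum>i<n. (if i = j then (\<lambda>z. \<rho> z + \<sigma> j z) else \<sigma> i) (h x) * g i x)"
      unfolding sum.distrib[symmetric] by (rule sum.cong) (auto simp: algebra_simps)
    finally show "\<psi> x = (\<Sum>i<n. (if i = j then (\<lambda>z. \<rho> z + \<sigma> j z) else \<sigma> i) (h x) * g i x)" .
  qed
qed

text \<open>The span of the finite set \<open>S\<close> is a ring of functions on \<open>Y\<close>; it is finite as a module over the
  pullback of \<open>R\<close>.\<close>

locale finite_extension = fun_algebra R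
  for R :: "('z \<Rightarrow> 'k::field) set" +
  fixes h :: "'x \<Rightarrow> 'z" and Y :: "'x set" and S :: "('x \<Rightarrow> 'k) set"
  assumes finite_gens: "finite S"
    and one_in_span: "(\<lambda>_. 1) \<in> rspan R h Y S"
    and gens_mult: "g \<in> S \<Longrightarrow> g' \<in> S \<Longrightarrow> (\<lambda>x. g x * g' x) \<in> rspan R h Y S"
begin

lemma span_pullback: "\<rho> \<in> R \<Longrightarrow> (\<lambda>x. \<rho> (h x)) \<in> rspan R h Y S"
  using rspan_smult[OF _ one_in_span, of \<rho> R] mult by simp

lemma gens_in_span: "g \<in> S \<Longrightarrow> g \<in> rspan R h Y S"
  by (rule rspan.step[of "\<lambda>_. 1" _ _ _ "\<lambda>_. 0"]) (auto intro: const rspan.zero)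

text \<open>The span with coefficients in an ideal \<open>I\<close> is an ideal of the full span.\<close>

lemma span_mult:
  assumes I: "I \<subseteq> R" "\<And>\<rho> \<sigma>. \<rho> \<in> I \<Longrightarrow> \<sigma> \<in> R \<Longrightarrow> (\<lambda>z. \<rho> z * \<sigma> z) \<in> I"
    and \<phi>: "\<phi> \<in> rspan I h Y S" and \<psi>: "\<psi> \<in> rspan R h Y S"
  shows "(\<lambda>x. \<phi> x * \<psi> x) \<in> rspan I h Y S"
  using \<phi>
proof (induction rule: rspan.induct)
  case (zero \<phi>)
  thus ?case by (auto intro: rspan.zero)
next
  case (step \<rho> g \<phi>1 \<phi>2)
  have g: "(\<lambda>x. g x * \<psi> x) \<in> rspan R h Y S"
    using \<psi>
  proof (induction rule: rspan.induct)
    case (zero \<phi>)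
    thus ?case by (auto intro: rspan.zero)
  next
    case (step \<sigma> g' \<psi>1 \<psi>2)
    have "(\<lambda>x. \<sigma> (h x) * (g x * g' x)) \<in> rspan R h Y S"
      by (rule rspan_smult[of R]) (use mult step gens_mult \<open>g \<in> S\<close> in auto)
    from rspan_add[OF this step.IH] show ?case
      by (rule rspan_cong) (use step.hyps in \<open>simp add: algebra_simps\<close>)
  qed
  have "(\<lambda>x. \<rho> (h x) * (g x * \<psi> x)) \<in> rspan I h Y S"
    by (rule rspan_smult[OF _ g]) (use I step in auto)
  from rspan_add[OF this step.IH] show ?case
    by (rule rspan_cong) (use step.hyps in \<open>simp add: algebra_simps\<close>)
qed

lemma fun_algebra_span: "fun_algebra (rspan R h Y S)"
proof
  show "(\<lambda>_. c) \<in> rspan R h Y S" for c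
    using span_pullback[OF const[of c]] .
qed (auto intro: rspan_add span_mult mult)

end

text \<open>Adjoining a root of a monic polynomial over \<open>R\<close>.\<close>

lemma (in finite_extension) adjoin_root:
  assumes G: "G \<in> poly_family R" and monic: "\<And>z. Polynomial.lead_coeff (G z) = 1" "\<And>z. Polynomial.degree (G z) = N"
    and root: "\<And>x. x \<in> Y \<Longrightarrow> poly (G (h x)) (\<tau> x) = 0"
  obtains S' where "finite_extension R h Y S'" "rspan R h Y S \<subseteq> rspan R h Y S'" "\<tau> \<in> rspan R h Y S'"
proof -
  define S' where "S' = (\<lambda>(g, i) x. g x * \<tau> x ^ i) ` (S \<times> {..<N})"
  let ?M = "rspan R h Y S" and ?M' = "rspan R h Y S'"
  interpret M: fun_algebra ?M by (rule fun_algebra_span)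
  \<comment> \<open>High powers of \<open>\<tau>\<close> are reduced with the monic equation.\<close>
  have key: "(\<lambda>x. b x * \<tau> x ^ i) \<in> ?M'" if "b \<in> ?M" for b i
    using that
  proof (induction i arbitrary: b rule: less_induct)
    case (less i)
    show ?case
    proof (cases "i < N")
      case True
      from less.prems show ?thesis
      proof (induction rule: rspan.induct)
        case (zero \<phi>)
        thus ?case by (auto intro: rspan.zero)
      next
        case (step \<rho> g \<phi> \<psi>)
        show ?case
          by (rule rspan.step[OF \<open>\<rho> \<in> R\<close> _ step.IH, of "\<lambda>x. g x * \<tau> x ^ i"])
             (use True step.hyps in \<open>auto simp: S'_def algebra_simps\<close>)
      qed
    next
      case False
      have pow: "\<tau> x ^ N = - (\<Sum>l<N. Polynomial.coeff (G (h x)) l * \<tau> x ^ l)" if "x \<in> Y" for x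
      proof -
        have "poly (G (h x)) (\<tau> x) = (\<Sum>l\<le>N. Polynomial.coeff (G (h x)) l * \<tau> x ^ l)"
          using monic(2) by (simp add: poly_altdef)
        also have "\<dots> = (\<Sum>l<N. Polynomial.coeff (G (h x)) l * \<tau> x ^ l) + \<tau> x ^ N"
          using monic[of "h x"] by (simp add: lessThan_Suc_atMost[symmetric])
        finally show ?thesis using root[OF that] by (simp add: eq_neg_iff_add_eq_0 add.commute)
      qed
      have summand: "(\<lambda>x. (- (b x * Polynomial.coeff (G (h x)) l)) * \<tau> x ^ (i - N + l)) \<in> ?M'" if "l < N" for l
        by (rule less.IH, use that False in simp,
            rule M.uminus, rule M.mult, rule less.prems, rule span_pullback, rule family_coeff, rule G)
      have "(\<lambda>x. \<Sum>l<n. (- (b x * Polynomial.coeff (G (h x)) l)) * \<tau> x ^ (i - N + l)) \<in> ?M'" if "n \<le> N" for n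
        using that
      proof (induction n)
        case 0 thus ?case by (auto intro: rspan.zero)
      next
        case (Suc n)
        thus ?case using rspan_add[OF Suc.IH summand, of n] by simp
      qed
      from this[of N] show ?thesis
      proof (rule rspan_cong)
        fix x assume x: "x \<in> Y"
        have "b x * \<tau> x ^ i = b x * \<tau> x ^ (i - N) * \<tau> x ^ N"
          using False by (simp add: power_add[symmetric] mult.assoc)
        also have "\<dots> = (\<Sum>l<N. (- (b x * Polynomial.coeff (G (h x)) l)) * \<tau> x ^ (i - N + l))"
          unfolding pow[OF x] by (simp add: sum_distrib_left sum_negf[symmetric] power_add algebra_simps)
        finally show "b x * \<tau> x ^ i = (\<Sum>l<N. (- (b x * Polynomial.coeff (G (h x)) l)) * \<tau> x ^ (i - N + l))" .
      qed simp
    qed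
  qed
  have sub: "?M \<subseteq> ?M'" using key[of _ 0] by auto
  show thesis
  proof
    show "\<tau> \<in> ?M'" using key[OF M.const[of 1], of 1] by simp
    show "finite_extension R h Y S'"
    proof
      show "finite S'" using finite_gens by (simp add: S'_def)
      show "(\<lambda>_. 1) \<in> ?M'" using sub one_in_span by blast
      fix g g' assume "g \<in> S'" "g' \<in> S'"
      then obtain a i b j where *: "a \<in> S" "b \<in> S" "g = (\<lambda>x. a x * \<tau> x ^ i)" "g' = (\<lambda>x. b x * \<tau> x ^ j)"
        by (auto simp: S'_def)
      have "(\<lambda>x. (a x * b x) * \<tau> x ^ (i + j)) \<in> ?M'"
        by (rule key) (use * gens_mult in auto)
      thus "(\<lambda>x. g x * g' x) \<in> ?M'"
        by (rule rspan_cong) (simp add: * power_add algebra_simps)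
    qed
  qed (rule sub)
qed

lemma adjoin_roots:
  fixes R :: "('z \<Rightarrow> 'k::field) set" and \<tau> :: "nat \<Rightarrow> 'x \<Rightarrow> 'k"
  assumes R: "fun_algebra R" and G: "G \<in> poly_family R" and monic: "\<And>z. Polynomial.lead_coeff (G z) = 1" "\<And>z. Polynomial.degree (G z) = N"
    and root: "\<And>x l. x \<in> Y \<Longrightarrow> l < r \<Longrightarrow> poly (G (h x)) (\<tau> l x) = 0"
  obtains S where "finite_extension R h Y S" "\<And>l. l < r \<Longrightarrow> \<tau> l \<in> rspan R h Y S"
proof -
  interpret fun_algebra R by (rule R)
  have "\<exists>S. finite_extension R h Y S \<and> (\<forall>l<r. \<tau> l \<in> rspan R h Y S)"
    using root
  proof (induction r)
    case 0
    have one: "(\<lambda>_. 1) \<in> rspan R h Y {\<lambda>_. 1}"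
      by (rule rspan.step[of "\<lambda>_. 1" _ _ _ "\<lambda>_. 0"]) (auto intro: const rspan.zero)
    have "finite_extension R h Y {\<lambda>_. 1}"
      by unfold_locales (use one in auto)
    thus ?case by blast
  next
    case (Suc r)
    then obtain S where S: "finite_extension R h Y S" "\<forall>l<r. \<tau> l \<in> rspan R h Y S" by auto
    obtain S' where "finite_extension R h Y S'" "rspan R h Y S \<subseteq> rspan R h Y S'" "\<tau> r \<in> rspan R h Y S'"
      using finite_extension.adjoin_root[OF S(1) G monic, of "\<tau> r"] Suc.prems by blast
    thus ?case using S(2) by (intro exI[of _ S']) (auto simp: less_Suc_eq)
  qed
  thus thesis using that by blast
qed

text \<open>A function which multiplies the generators into the submodule with coefficients in an ideal \<open>I\<close>
  satisfies a monic equation over \<open>R\<close>, which becomes \<open>T ^ n = 0\<close> at the common zeros of \<open>I\<close>.\<close>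

lemma (in finite_extension) determinant_trick:
  assumes I: "I \<subseteq> R" "(\<lambda>_. 0) \<in> I" "\<And>\<rho> \<sigma>. \<rho> \<in> I \<Longrightarrow> \<sigma> \<in> I \<Longrightarrow> (\<lambda>z. \<rho> z + \<sigma> z) \<in> I"
    and \<phi>: "\<And>g. g \<in> S \<Longrightarrow> (\<lambda>x. \<phi> x * g x) \<in> rspan I h Y S"
  obtains Q n where "Q \<in> poly_family R" "\<And>z. Polynomial.lead_coeff (Q z) = 1" "\<And>z. Polynomial.degree (Q z) = n"
    "\<And>x. x \<in> Y \<Longrightarrow> poly (Q (h x)) (\<phi> x) = 0" "\<And>z. (\<And>\<rho>. \<rho> \<in> I \<Longrightarrow> \<rho> z = 0) \<Longrightarrow> Q z = [:0, 1:] ^ n"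
proof -
  obtain g and n :: nat where "S = g ` {i. i < n}"
    using finite_imp_nat_seg_image_inj_on[OF finite_gens] by auto
  hence S: "S = g ` {..<n}" by (simp add: lessThan_def)
  have "\<exists>\<rho>. (\<forall>j<n. \<rho> j \<in> I) \<and> (\<forall>x\<in>Y. \<phi> x * g i x = (\<Sum>j<n. \<rho> j (h x) * g j x))" if "i < n" for i
    using rspan_repr[of "\<lambda>x. \<phi> x * g i x" I h Y g n] \<phi> I that by (auto simp: S)
  then obtain \<beta> where \<beta>: "\<And>i j. i < n \<Longrightarrow> j < n \<Longrightarrow> \<beta> i j \<in> I"
      "\<And>i x. i < n \<Longrightarrow> x \<in> Y \<Longrightarrow> \<phi> x * g i x = (\<Sum>j<n. \<beta> i j (h x) * g j x)"
    by metis
  define A where "A z = mat n n (\<lambda>(i, j). \<beta> i j z)" for z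
  have A: "A z \<in> carrier_mat n n" for z by (simp add: A_def)
  show thesis
  proof (rule that[of "\<lambda>z. char_poly (A z)" n])
    show "(\<lambda>z. char_poly (A z)) \<in> poly_family R"
      unfolding A_def by (rule char_poly_family) (use \<beta> I in auto)
    show "Polynomial.lead_coeff (char_poly (A z)) = 1" "Polynomial.degree (char_poly (A z)) = n" for z
      using degree_monic_char_poly[OF A] by (auto simp: monic_degree_0)
    show "char_poly (A z) = [:0, 1:] ^ n" if "\<And>\<rho>. \<rho> \<in> I \<Longrightarrow> \<rho> z = 0" for z
    proof -
      have "A z = mat n n (\<lambda>_. 0)"
        unfolding A_def by (rule eq_matI) (use that \<beta> in auto)
      thus ?thesis by (simp add: char_poly_zero_mat)
    qed
    fix x assume x: "x \<in> Y"
    have "\<exists>\<rho>. (\<forall>j<n. \<rho> j \<in> R) \<and> (\<forall>x\<in>Y. 1 = (\<Sum>j<n. \<rho> j (h x) * g j x))"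
      using rspan_repr[of "\<lambda>x. 1" R h Y g n] one_in_span const add by (auto simp: S)
    then obtain \<rho> where "1 = (\<Sum>j<n. \<rho> j (h x) * g j x)" using x by blast
    hence "\<exists>j<n. g j x \<noteq> 0"
      by (metis (no_types, lifting) lessThan_iff mult_zero_right sum.neutral zero_neq_one)
    thus "poly (char_poly (A (h x))) (\<phi> x) = 0"
      unfolding A_def using poly_char_poly_eq_0[of _ n "\<lambda>j. g j x" "\<lambda>i j. \<beta> i j (h x)" "\<phi> x"] \<beta>(2) x
      by auto
  qed
qed

lemma (in finite_extension) integral_element:
  assumes \<phi>: "\<phi> \<in> rspan R h Y S"
  obtains Q n where "Q \<in> poly_family R" "\<And>z. Polynomial.lead_coeff (Q z) = 1" "\<And>z. Polynomial.degree (Q z) = n"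
    "\<And>x. x \<in> Y \<Longrightarrow> poly (Q (h x)) (\<phi> x) = 0"
proof -
  have *: "(\<lambda>x. \<phi> x * g x) \<in> rspan R h Y S" if "g \<in> S" for g
    by (rule span_mult) (use that mult \<phi> gens_in_span in auto)
  show thesis
  proof (rule determinant_trick[of R \<phi>])
    show "(\<lambda>x. \<phi> x * g x) \<in> rspan R h Y S" if "g \<in> S" for g
      using that by (rule *)
    fix Q n
    assume "Q \<in> poly_family R" "\<And>z. Polynomial.lead_coeff (Q z) = 1" "\<And>z. Polynomial.degree (Q z) = n"
      "\<And>x. x \<in> Y \<Longrightarrow> poly (Q (h x)) (\<phi> x) = 0"
    thus thesis by (rule that)
  qed (use const add in auto)
qed

section \<open>Images under finite maps are closed\<close>

text \<open>If an element \<open>a\<close> satisfies a nonzero polynomial equation over the ground field modulo a proper ideal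
  \<open>J\<close>, then for some scalar \<open>\<tau>\<close> the ideal generated by \<open>J\<close> and \<open>a - \<tau>\<close> is still proper: otherwise the
  linear factors of the polynomial could be cancelled modulo \<open>J\<close> one after the other.\<close>

lemma proper_ideal_extend:
  fixes M :: "('x \<Rightarrow> 'k::alg_closed_field) set"
  assumes M: "fun_algebra M" and a: "a \<in> M"
    and ideal: "J \<subseteq> M" "\<And>\<phi> \<psi>. \<phi> \<in> J \<Longrightarrow> \<psi> \<in> J \<Longrightarrow> (\<lambda>x. \<phi> x + \<psi> x) \<in> J" "\<And>\<phi> \<psi>. \<phi> \<in> J \<Longrightarrow> \<psi> \<in> M \<Longrightarrow> (\<lambda>x. \<phi> x * \<psi> x) \<in> J"
    and proper: "(\<lambda>_. 1) \<notin> J"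
    and p: "p \<noteq> 0" "(\<lambda>x. poly p (a x)) \<in> J"
  obtains \<tau> where "\<And>\<phi> \<psi>. \<phi> \<in> J \<Longrightarrow> \<psi> \<in> M \<Longrightarrow> (\<lambda>x. \<phi> x + \<psi> x * (a x - \<tau>)) \<noteq> (\<lambda>_. 1)"
proof -
  interpret M: fun_algebra M by (rule M)
  have "\<exists>\<tau>. \<forall>\<phi>\<in>J. \<forall>\<psi>\<in>M. (\<lambda>x. \<phi> x + \<psi> x * (a x - \<tau>)) \<noteq> (\<lambda>_. 1)"
    using p
  proof (induction "Polynomial.degree p" arbitrary: p rule: less_induct)
    case less
    show ?case
    proof (cases "Polynomial.degree p = 0")
      case True
      then obtain c where c: "p = [:c:]" "c \<noteq> 0" using less.prems by (auto elim!: degree_eq_zeroE)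
      have "(\<lambda>x. poly p (a x) * inverse c) \<in> J"
        by (rule ideal(3)[OF less.prems(2) M.const])
      hence False using proper c by simp
      thus ?thesis ..
    next
      case False
      then obtain \<tau> where "poly p \<tau> = 0" using alg_closed_imp_poly_has_root by blast
      then obtain q where q: "p = [:-\<tau>, 1:] * q" by (auto simp: poly_eq_0_iff_dvd dvd_def)
      show ?thesis
      proof (rule ccontr)
        assume contr: "\<not> ?thesis"
        then obtain \<phi> \<psi> where *: "\<phi> \<in> J" "\<psi> \<in> M" "(\<lambda>x. \<phi> x + \<psi> x * (a x - \<tau>)) = (\<lambda>_. 1)" by blast
        have qa: "(\<lambda>x. poly q (a x)) \<in> M"
          unfolding poly_altdef by (intro M.sum M.mult M.power a M.const)
        have "(\<lambda>x. \<phi> x * poly q (a x) + poly p (a x) * \<psi> x) \<in> J"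
          using * qa less.prems by (intro ideal)
        also have "(\<lambda>x. \<phi> x * poly q (a x) + poly p (a x) * \<psi> x) =
            (\<lambda>x. (\<phi> x + \<psi> x * (a x - \<tau>)) * poly q (a x))"
          by (rule ext) (simp add: q algebra_simps)
        also have "\<dots> = (\<lambda>x. poly q (a x))" using fun_cong[OF *(3)] by simp
        finally have qJ: "(\<lambda>x. poly q (a x)) \<in> J" .
        have "q \<noteq> 0" using less.prems q by auto
        hence "Polynomial.degree q < Polynomial.degree p" unfolding q by (subst degree_mult_eq) auto
        from less.hyps[OF this \<open>q \<noteq> 0\<close> qJ] contr show False by blast
      qed
    qed
  qed
  thus thesis using that by blast
qed

text \<open>Here \<open>h\<close> is a finite map from \<open>Y\<close>, the components of \<open>c\<close>, a map from \<open>Y\<close> to affine space, lie in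
  the finite extension, and \<open>z\<close> lies in the closure of \<open>h(Y)\<close>. Then \<open>z\<close> lifts to a point \<open>\<xi>\<close> which
  satisfies all the relations between \<open>c\<close> and \<open>h\<close> that hold on \<open>Y\<close>. Functions vanishing at \<open>z\<close> generate
  a proper ideal by the determinant trick, and the coordinates of \<open>\<xi>\<close> are found one by one, as roots of
  monic equations, keeping the ideal proper.\<close>

lemma finite_image_closed:
  fixes R :: "('z \<Rightarrow> 'k::alg_closed_field) set"
  assumes fin: "finite_extension R h Y S"
    and c: "\<And>i. i < D \<Longrightarrow> (\<lambda>x. c x i) \<in> rspan R h Y S"
    and z: "\<And>\<rho>. \<rho> \<in> R \<Longrightarrow> (\<And>x. x \<in> Y \<Longrightarrow> \<rho> (h x) = 0) \<Longrightarrow> \<rho> z = 0"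
  obtains \<xi> where "\<xi> \<in> affine_space D"
    "\<And>b \<rho>. b \<in> polyfuns D \<Longrightarrow> \<rho> \<in> R \<Longrightarrow> (\<And>x. x \<in> Y \<Longrightarrow> b (c x) = \<rho> (h x)) \<Longrightarrow> b \<xi> = \<rho> z"
proof -
  interpret finite_extension R h Y S by (rule fin)
  define M where "M = rspan R h Y S"
  interpret M: fun_algebra M unfolding M_def by (rule fun_algebra_span)
  define I where "I = {\<rho> \<in> R. \<rho> z = 0}"
  have I: "I \<subseteq> R" "(\<lambda>_. 0) \<in> I" "\<And>\<rho> \<sigma>. \<rho> \<in> I \<Longrightarrow> \<sigma> \<in> I \<Longrightarrow> (\<lambda>z. \<rho> z + \<sigma> z) \<in> I"
      "\<And>\<rho> \<sigma>. \<rho> \<in> I \<Longrightarrow> \<sigma> \<in> R \<Longrightarrow> (\<lambda>z. \<rho> z * \<sigma> z) \<in> I"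
    using const add mult by (auto simp: I_def)
  define J0 where "J0 = rspan I h Y S"
  define ideal where "ideal J \<longleftrightarrow> J \<subseteq> M \<and> J0 \<subseteq> J \<and> (\<forall>\<phi>\<in>J. \<forall>\<psi>\<in>J. (\<lambda>x. \<phi> x + \<psi> x) \<in> J) \<and>
      (\<forall>\<phi>\<in>J. \<forall>\<psi>\<in>M. (\<lambda>x. \<phi> x * \<psi> x) \<in> J)" for J
  have J0_pullback: "(\<lambda>x. \<rho> (h x)) \<in> J0" if "\<rho> \<in> I" for \<rho>
  proof -
    have "(\<lambda>x. \<rho> (h x) * 1) \<in> rspan I h Y S"
      by (rule rspan_smult[OF _ one_in_span]) (use that I in auto)
    thus ?thesis by (simp add: J0_def)
  qed
  have J0: "ideal J0"
    unfolding ideal_def J0_def M_def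
  proof (intro conjI ballI)
    show "rspan I h Y S \<subseteq> rspan R h Y S" by (rule rspan_mono) (use I in auto)
    show "(\<lambda>x. \<phi> x * \<psi> x) \<in> rspan I h Y S" if "\<phi> \<in> rspan I h Y S" "\<psi> \<in> rspan R h Y S" for \<phi> \<psi>
      by (rule span_mult[OF I(1,4) that])
  qed (auto intro: rspan_add)
  have proper: "(\<lambda>_. 1) \<notin> J0"
  proof
    assume one: "(\<lambda>_. 1) \<in> J0"
    have *: "(\<lambda>x. 1 * g x) \<in> rspan I h Y S" if "g \<in> S" for g
      by (rule span_mult[OF _ _ one[unfolded J0_def]]) (use I that gens_in_span in auto)
    obtain Q n where Q: "Q \<in> poly_family R" "\<And>x. x \<in> Y \<Longrightarrow> poly (Q (h x)) 1 = 0"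
        "(\<And>\<rho>. \<rho> \<in> I \<Longrightarrow> \<rho> z = 0) \<Longrightarrow> Q z = [:0, 1:] ^ n"
      using determinant_trick[OF I(1-3) *] by metis
    have "(\<lambda>z. poly (Q z) 1) \<in> R"
      by (rule family_eval[OF Q(1) const])
    from z[OF this] Q(2) have "poly (Q z) 1 = 0" by blast
    moreover have "Q z = [:0, 1:] ^ n" by (rule Q(3)) (auto simp: I_def)
    ultimately show False by simp
  qed
  have "\<exists>\<xi> J. ideal J \<and> (\<lambda>_. 1) \<notin> J \<and> (\<forall>i<n. (\<lambda>x. c x i - \<xi> i) \<in> J)" if "n \<le> D" for n
    using that
  proof (induction n)
    case 0
    thus ?case using J0 proper by auto
  next
    case (Suc n)
    then obtain \<xi> J where J: "ideal J" "(\<lambda>_. 1) \<notin> J" "\<forall>i<n. (\<lambda>x. c x i - \<xi> i) \<in> J" by auto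
    have ideal: "J \<subseteq> M" "J0 \<subseteq> J" "\<And>\<phi> \<psi>. \<phi> \<in> J \<Longrightarrow> \<psi> \<in> J \<Longrightarrow> (\<lambda>x. \<phi> x + \<psi> x) \<in> J"
        "\<And>\<phi> \<psi>. \<phi> \<in> J \<Longrightarrow> \<psi> \<in> M \<Longrightarrow> (\<lambda>x. \<phi> x * \<psi> x) \<in> J"
      using J(1) by (simp_all add: ideal_def)
    let ?a = "\<lambda>x. c x n"
    have a: "?a \<in> M" using c Suc.prems by (simp add: M_def)
    obtain Q N where Q: "Q \<in> poly_family R" "\<And>z. Polynomial.lead_coeff (Q z) = 1"
        "\<And>z. Polynomial.degree (Q z) = N" "\<And>x. x \<in> Y \<Longrightarrow> poly (Q (h x)) (?a x) = 0"
      using integral_element[of ?a] a unfolding M_def by metis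
    \<comment> \<open>Replacing the coefficients of the monic equation of the coordinate by their values at \<open>z\<close> changes
      it by an element of the ideal.\<close>
    have "(\<lambda>x. poly (Q z) (?a x)) \<in> J"
    proof -
      have coeffJ: "(\<lambda>x. (Polynomial.coeff (Q z) i - Polynomial.coeff (Q (h x)) i) * ?a x ^ i) \<in> J" for i
      proof (rule ideal(4)[OF subsetD[OF ideal(2) J0_pullback] M.power[OF a]])
        show "(\<lambda>w. Polynomial.coeff (Q z) i - Polynomial.coeff (Q w) i) \<in> I"
          unfolding I_def using diff[OF const family_coeff[OF Q(1)]] by auto
      qed
      have "(\<lambda>x. \<Sum>i\<le>m. (Polynomial.coeff (Q z) i - Polynomial.coeff (Q (h x)) i) * ?a x ^ i) \<in> J" for m
      proof (induction m)
        case 0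
        show ?case using coeffJ[of 0] by simp
      next
        case (Suc m)
        show ?case using ideal(3)[OF Suc.IH coeffJ[of "Suc m"]] by simp
      qed
      hence diffJ: "(\<lambda>x. poly (Q z) (?a x) - poly (Q (h x)) (?a x)) \<in> J"
        using Q(3) by (simp add: poly_altdef sum_subtractf left_diff_distrib)
      have zeroJ: "(\<lambda>x. poly (Q (h x)) (?a x)) \<in> J"
        by (rule subsetD[OF ideal(2)]) (use Q(4) in \<open>auto simp: J0_def intro!: rspan.zero\<close>)
      show ?thesis using ideal(3)[OF diffJ zeroJ] by simp
    qed
    moreover have "Q z \<noteq> 0" using Q(2)[of z] by auto
    ultimately obtain \<tau> where \<tau>: "\<And>\<phi> \<psi>. \<phi> \<in> J \<Longrightarrow> \<psi> \<in> M \<Longrightarrow> (\<lambda>x. \<phi> x + \<psi> x * (?a x - \<tau>)) \<noteq> (\<lambda>_. 1)"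
      using proper_ideal_extend[OF M.fun_algebra_axioms a ideal(1,3,4) J(2), of "Q z"] by blast
    define J' where "J' = {(\<lambda>x. \<phi> x + \<psi> x * (?a x - \<tau>)) | \<phi> \<psi>. \<phi> \<in> J \<and> \<psi> \<in> M}"
    have sub: "J \<subseteq> J'"
    proof
      fix \<phi> assume "\<phi> \<in> J"
      thus "\<phi> \<in> J'" unfolding J'_def using M.const[of 0] by (intro CollectI exI[of _ \<phi>] exI[of _ "\<lambda>_. 0"]) auto
    qed
    have at: "(\<lambda>x. ?a x - \<tau>) \<in> M" by (intro M.diff a M.const)
    show ?case
    proof (intro exI conjI allI impI)
      show "ideal J'"
        unfolding ideal_def
      proof (intro conjI ballI)
        show "J0 \<subseteq> J'" using sub ideal(2) by blast
        show "J' \<subseteq> M" unfolding J'_def using ideal(1) at by (auto intro!: M.add M.mult)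
        fix \<phi> assume "\<phi> \<in> J'"
        then obtain \<phi>1 \<phi>2 where \<phi>: "\<phi>1 \<in> J" "\<phi>2 \<in> M" "\<phi> = (\<lambda>x. \<phi>1 x + \<phi>2 x * (?a x - \<tau>))"
          by (auto simp: J'_def)
        show "(\<lambda>x. \<phi> x + \<psi> x) \<in> J'" if "\<psi> \<in> J'" for \<psi>
        proof -
          from that obtain \<psi>1 \<psi>2 where \<psi>: "\<psi>1 \<in> J" "\<psi>2 \<in> M" "\<psi> = (\<lambda>x. \<psi>1 x + \<psi>2 x * (?a x - \<tau>))"
            by (auto simp: J'_def)
          have "(\<lambda>x. \<phi>1 x + \<psi>1 x) \<in> J" "(\<lambda>x. \<phi>2 x + \<psi>2 x) \<in> M"
            using \<phi> \<psi> by (simp_all add: ideal(3) M.add)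
          thus ?thesis unfolding J'_def
            by (intro CollectI exI[of _ "\<lambda>x. \<phi>1 x + \<psi>1 x"] exI[of _ "\<lambda>x. \<phi>2 x + \<psi>2 x"])
               (auto simp: \<phi> \<psi> algebra_simps)
        qed
        show "(\<lambda>x. \<phi> x * \<psi> x) \<in> J'" if "\<psi> \<in> M" for \<psi>
        proof -
          have "(\<lambda>x. \<phi>1 x * \<psi> x) \<in> J" "(\<lambda>x. \<phi>2 x * \<psi> x) \<in> M"
            using \<phi> that by (simp_all add: ideal(4) M.mult)
          thus ?thesis unfolding J'_def
            by (intro CollectI exI[of _ "\<lambda>x. \<phi>1 x * \<psi> x"] exI[of _ "\<lambda>x. \<phi>2 x * \<psi> x"])
               (auto simp: \<phi> algebra_simps)
        qed
      qed
      show "(\<lambda>_. 1) \<notin> J'"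
      proof
        assume "(\<lambda>_. 1) \<in> J'"
        then obtain \<phi> \<psi> where *: "\<phi> \<in> J" "\<psi> \<in> M" "(\<lambda>_. 1) = (\<lambda>x. \<phi> x + \<psi> x * (?a x - \<tau>))"
          unfolding J'_def by blast
        from \<tau>[OF *(1,2)] *(3) show False by simp
      qed
      fix i assume i: "i < Suc n"
      show "(\<lambda>x. c x i - (\<xi>(n := \<tau>)) i) \<in> J'"
      proof (cases "i = n")
        case True
        have "(\<lambda>_. 0) \<in> J" by (rule subsetD[OF ideal(2)]) (auto simp: J0_def intro!: rspan.zero)
        thus ?thesis unfolding J'_def using True M.const[of 1]
          by (intro CollectI exI[of _ "\<lambda>_. 0"] exI[of _ "\<lambda>_. 1"]) auto
      next
        case False
        thus ?thesis using J(3) sub i by auto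
      qed
    qed
  qed
  then obtain \<xi>' J where J: "ideal J" "(\<lambda>_. 1) \<notin> J" "\<And>i. i < D \<Longrightarrow> (\<lambda>x. c x i - \<xi>' i) \<in> J" by blast
  have ideal: "J0 \<subseteq> J" "\<And>\<phi> \<psi>. \<phi> \<in> J \<Longrightarrow> \<psi> \<in> J \<Longrightarrow> (\<lambda>x. \<phi> x + \<psi> x) \<in> J"
      "\<And>\<phi> \<psi>. \<phi> \<in> J \<Longrightarrow> \<psi> \<in> M \<Longrightarrow> (\<lambda>x. \<phi> x * \<psi> x) \<in> J"
    using J(1) by (simp_all add: ideal_def)
  define \<xi> where "\<xi> = restrict \<xi>' {..<D}"
  have eval: "(\<lambda>x. b (c x)) \<in> M \<and> (\<lambda>x. b (c x) - b \<xi>) \<in> J" if "b \<in> polyfuns D" for b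
    using that
  proof (induction rule: polyfuns.induct)
    case (const a)
    have "(\<lambda>_. 0) \<in> J" by (rule subsetD[OF ideal(1)]) (auto simp: J0_def intro!: rspan.zero)
    thus ?case using M.const by auto
  next
    case (coord i)
    thus ?case using J(3) c by (auto simp: \<xi>_def M_def)
  next
    case (add f g)
    have "(\<lambda>x. (f (c x) - f \<xi>) + (g (c x) - g \<xi>)) \<in> J"
      by (rule ideal(2)) (use add.IH in auto)
    moreover have "(\<lambda>x. (f (c x) - f \<xi>) + (g (c x) - g \<xi>)) = (\<lambda>x. f (c x) + g (c x) - (f \<xi> + g \<xi>))"
      by (rule ext) (simp add: algebra_simps)
    ultimately show ?case using add.IH M.add by simp
  next
    case (mult f g)
    have "(\<lambda>x. (f (c x) - f \<xi>) * g (c x)) \<in> J" "(\<lambda>x. (g (c x) - g \<xi>) * f \<xi>) \<in> J"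
      using mult.IH by (auto intro!: ideal(3) M.const)
    hence "(\<lambda>x. (f (c x) - f \<xi>) * g (c x) + (g (c x) - g \<xi>) * f \<xi>) \<in> J"
      by (rule ideal(2))
    moreover have "(\<lambda>x. (f (c x) - f \<xi>) * g (c x) + (g (c x) - g \<xi>) * f \<xi>) =
        (\<lambda>x. f (c x) * g (c x) - f \<xi> * g \<xi>)"
      by (rule ext) (simp add: algebra_simps)
    ultimately show ?case using mult.IH M.mult by simp
  qed
  show thesis
  proof
    show "\<xi> \<in> affine_space D" by (simp add: \<xi>_def affine_space_def)
    fix b \<rho> assume b: "b \<in> polyfuns D" and \<rho>: "\<rho> \<in> R" and eq: "\<And>x. x \<in> Y \<Longrightarrow> b (c x) = \<rho> (h x)"
    have "(\<lambda>w. \<rho> w - \<rho> z) \<in> I" using diff[OF \<rho> const] by (simp add: I_def)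
    from J0_pullback[OF this] have "(\<lambda>x. \<rho> (h x) - \<rho> z) \<in> J0" .
    hence "(\<lambda>x. b (c x) - \<rho> z) \<in> J0" unfolding J0_def by (rule rspan_cong) (simp add: eq)
    hence 1: "(\<lambda>x. b (c x) - \<rho> z) \<in> J" by (rule subsetD[OF ideal(1)])
    have 2: "(\<lambda>x. (b (c x) - b \<xi>) * (-1)) \<in> J" by (rule ideal(3)[OF conjunct2[OF eval[OF b]] M.const])
    have 3: "(\<lambda>_. b \<xi> - \<rho> z) \<in> J" using ideal(2)[OF 1 2] by simp
    show "b \<xi> = \<rho> z"
    proof (rule ccontr)
      assume "b \<xi> \<noteq> \<rho> z"
      moreover have "(\<lambda>_. (b \<xi> - \<rho> z) * inverse (b \<xi> - \<rho> z)) \<in> J"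
        by (rule ideal(3)[OF 3 M.const])
      ultimately show False using J(2) by simp
    qed
  qed
qed

section \<open>The fraction field of a domain\<close>

context "domain"
begin

lemma equiv_frac_rel: "equiv (carrier R \<times> (carrier R - {\<zero>})) (frac_rel R)"
proof (rule equivI)
  show "frac_rel R \<subseteq> (carrier R \<times> (carrier R - {\<zero>})) \<times> (carrier R \<times> (carrier R - {\<zero>}))"
    by (auto simp: frac_rel_def)
  show "refl_on (carrier R \<times> (carrier R - {\<zero>})) (frac_rel R)"
    by (auto simp: refl_on_def frac_rel_def)
  show "sym (frac_rel R)"
    by (auto simp: sym_def frac_rel_def)
  show "trans (frac_rel R)"
  proof (rule transI, clarsimp simp: frac_rel_def)
    fix a b c d e f
    assume *: "a \<in> carrier R" "b \<in> carrier R" "b \<noteq> \<zero>" "c \<in> carrier R" "d \<in> carrier R" "d \<noteq> \<zero>"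
      "e \<in> carrier R" "f \<in> carrier R" "f \<noteq> \<zero>" and eq: "a \<otimes> d = c \<otimes> b" "c \<otimes> f = e \<otimes> d"
    have "d \<otimes> (a \<otimes> f) = (a \<otimes> d) \<otimes> f" using * by (simp add: m_ac)
    also have "\<dots> = b \<otimes> (c \<otimes> f)" unfolding eq(1) using * by (simp add: m_ac)
    also have "\<dots> = d \<otimes> (e \<otimes> b)" unfolding eq(2) using * by (simp add: m_ac)
    finally show "a \<otimes> f = e \<otimes> b" using * m_lcancel[of d "a \<otimes> f" "e \<otimes> b"] by simp
  qed
qed

lemma frac_eq_iff:
  assumes "a \<in> carrier R" "b \<in> carrier R" "b \<noteq> \<zero>" "c \<in> carrier R" "d \<in> carrier R" "d \<noteq> \<zero>"
  shows "frac R a b = frac R c d \<longleftrightarrow> a \<otimes> d = c \<otimes> b"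
proof -
  have "frac R a b = frac R c d \<longleftrightarrow> ((a, b), (c, d)) \<in> frac_rel R"
    unfolding frac_def by (rule eq_equiv_class_iff[OF equiv_frac_rel]) (use assms in auto)
  thus ?thesis using assms by (simp add: frac_rel_def)
qed

lemma carrier_fraction_field:
  "carrier (fraction_field R) = {frac R a b | a b. a \<in> carrier R \<and> b \<in> carrier R \<and> b \<noteq> \<zero>}"
  by (auto simp: fraction_field_def quotient_def frac_def)

lemma frac_rep:
  assumes "a \<in> carrier R" "b \<in> carrier R" "b \<noteq> \<zero>"
  shows "(a, b) \<in> frac R a b"
  using assms by (auto simp: frac_def frac_rel_def)

lemma frac_memD:
  assumes "(a', b') \<in> frac R a b"
  shows "a' \<in> carrier R" "b' \<in> carrier R" "b' \<noteq> \<zero>" "a \<otimes> b' = a' \<otimes> b"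
  using assms by (auto simp: frac_def frac_rel_def)

lemma frac_mult:
  assumes ab: "a \<in> carrier R" "b \<in> carrier R" "b \<noteq> \<zero>" and cd: "c \<in> carrier R" "d \<in> carrier R" "d \<noteq> \<zero>"
  shows "frac R a b \<otimes>\<^bsub>fraction_field R\<^esub> frac R c d = frac R (a \<otimes> c) (b \<otimes> d)"
proof -
  have *: "frac R (a' \<otimes> c') (b' \<otimes> d') = frac R (a \<otimes> c) (b \<otimes> d)"
    if "(a', b') \<in> frac R a b" "(c', d') \<in> frac R c d" for a' b' c' d'
  proof -
    note 1 = frac_memD[OF that(1)] and 2 = frac_memD[OF that(2)]
    have "(a' \<otimes> c') \<otimes> (b \<otimes> d) = (a' \<otimes> b) \<otimes> (c' \<otimes> d)" using 1(1-3) 2(1-3) ab cd by (simp add: m_ac)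
    also have "\<dots> = (a \<otimes> b') \<otimes> (c \<otimes> d')" using 1 2 by simp
    also have "\<dots> = (a \<otimes> c) \<otimes> (b' \<otimes> d')" using 1(1-3) 2(1-3) ab cd by (simp add: m_ac)
    finally show ?thesis using 1 2 ab cd by (subst frac_eq_iff) (auto simp: integral_iff)
  qed
  have "frac R a b \<otimes>\<^bsub>fraction_field R\<^esub> frac R c d =
      (\<Union>(a, b)\<in>frac R a b. \<Union>(c, d)\<in>frac R c d. frac R (a \<otimes> c) (b \<otimes> d))"
    by (simp add: fraction_field_def)
  also have "\<dots> = (\<Union>p\<in>frac R a b. \<Union>q\<in>frac R c d. frac R (a \<otimes> c) (b \<otimes> d))"
    by (intro SUP_cong refl) (auto simp: *)
  also have "\<dots> = frac R (a \<otimes> c) (b \<otimes> d)"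
    using frac_rep[OF ab] frac_rep[OF cd] by auto
  finally show ?thesis .
qed

lemma frac_add:
  assumes ab: "a \<in> carrier R" "b \<in> carrier R" "b \<noteq> \<zero>" and cd: "c \<in> carrier R" "d \<in> carrier R" "d \<noteq> \<zero>"
  shows "frac R a b \<oplus>\<^bsub>fraction_field R\<^esub> frac R c d = frac R (a \<otimes> d \<oplus> c \<otimes> b) (b \<otimes> d)"
proof -
  have *: "frac R (a' \<otimes> d' \<oplus> c' \<otimes> b') (b' \<otimes> d') = frac R (a \<otimes> d \<oplus> c \<otimes> b) (b \<otimes> d)"
    if "(a', b') \<in> frac R a b" "(c', d') \<in> frac R c d" for a' b' c' d'
  proof -
    note 1 = frac_memD[OF that(1)] and 2 = frac_memD[OF that(2)]
    have "(a' \<otimes> d' \<oplus> c' \<otimes> b') \<otimes> (b \<otimes> d) = (a' \<otimes> b) \<otimes> (d' \<otimes> d) \<oplus> (c' \<otimes> d) \<otimes> (b' \<otimes> b)"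
      using 1(1-3) 2(1-3) ab cd by (simp add: m_ac l_distr r_distr)
    also have "\<dots> = (a \<otimes> b') \<otimes> (d' \<otimes> d) \<oplus> (c \<otimes> d') \<otimes> (b' \<otimes> b)" using 1 2 by simp
    also have "\<dots> = (a \<otimes> d \<oplus> c \<otimes> b) \<otimes> (b' \<otimes> d')" using 1(1-3) 2(1-3) ab cd by (simp add: m_ac l_distr r_distr)
    finally show ?thesis using 1 2 ab cd by (subst frac_eq_iff) (auto simp: integral_iff)
  qed
  have "frac R a b \<oplus>\<^bsub>fraction_field R\<^esub> frac R c d =
      (\<Union>(a, b)\<in>frac R a b. \<Union>(c, d)\<in>frac R c d. frac R (a \<otimes> d \<oplus> c \<otimes> b) (b \<otimes> d))"
    by (simp add: fraction_field_def)
  also have "\<dots> = (\<Union>p\<in>frac R a b. \<Union>q\<in>frac R c d. frac R (a \<otimes> d \<oplus> c \<otimes> b) (b \<otimes> d))"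
    by (intro SUP_cong refl) (auto simp: *)
  also have "\<dots> = frac R (a \<otimes> d \<oplus> c \<otimes> b) (b \<otimes> d)"
    using frac_rep[OF ab] frac_rep[OF cd] by auto
  finally show ?thesis .
qed

lemma ring_fraction_field: "ring (fraction_field R)"
proof -
  let ?L = "fraction_field R"
  have one: "\<one>\<^bsub>?L\<^esub> = frac R \<one> \<one>" and zero: "\<zero>\<^bsub>?L\<^esub> = frac R \<zero> \<one>"
    by (simp_all add: fraction_field_def)
  have closed: "frac R a b \<in> carrier ?L" if "a \<in> carrier R" "b \<in> carrier R" "b \<noteq> \<zero>" for a b
    using that by (auto simp: carrier_fraction_field)
  have cases: "\<exists>a b. x = frac R a b \<and> a \<in> carrier R \<and> b \<in> carrier R \<and> b \<noteq> \<zero>" if "x \<in> carrier ?L" for x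
    using that by (auto simp: carrier_fraction_field)
  show ?thesis
  proof (rule ringI)
    show "abelian_group ?L"
    proof (rule abelian_groupI)
      fix x y z assume car: "x \<in> carrier ?L" "y \<in> carrier ?L" "z \<in> carrier ?L"
      from cases[OF car(1)] obtain a b where x: "x = frac R a b" "a \<in> carrier R" "b \<in> carrier R" "b \<noteq> \<zero>" by blast
      from cases[OF car(2)] obtain c d where y: "y = frac R c d" "c \<in> carrier R" "d \<in> carrier R" "d \<noteq> \<zero>" by blast
      from cases[OF car(3)] obtain e f where z: "z = frac R e f" "e \<in> carrier R" "f \<in> carrier R" "f \<noteq> \<zero>" by blast
      note xyz = x y z
      show "x \<oplus>\<^bsub>?L\<^esub> y \<in> carrier ?L" using xyz by (simp add: frac_add closed integral_iff)
      show "x \<oplus>\<^bsub>?L\<^esub> y \<oplus>\<^bsub>?L\<^esub> z = x \<oplus>\<^bsub>?L\<^esub> (y \<oplus>\<^bsub>?L\<^esub> z)"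
        using xyz by (simp add: frac_add integral_iff) (simp add: l_distr r_distr m_ac a_ac)
      show "x \<oplus>\<^bsub>?L\<^esub> y = y \<oplus>\<^bsub>?L\<^esub> x"
        using xyz by (simp add: frac_add m_comm a_comm)
      show "\<zero>\<^bsub>?L\<^esub> \<oplus>\<^bsub>?L\<^esub> x = x" using xyz by (simp add: zero frac_add)
      show "\<exists>y\<in>carrier ?L. y \<oplus>\<^bsub>?L\<^esub> x = \<zero>\<^bsub>?L\<^esub>"
      proof
        show "frac R (\<ominus> a) b \<in> carrier ?L" using x closed by simp
        have "(\<ominus> a \<otimes> b \<oplus> a \<otimes> b) \<otimes> \<one> = \<zero> \<otimes> (b \<otimes> b)" using x by (simp add: l_minus l_neg)
        thus "frac R (\<ominus> a) b \<oplus>\<^bsub>?L\<^esub> x = \<zero>\<^bsub>?L\<^esub>" unfolding zero x(1)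
          using x by (subst frac_add) (auto simp: frac_eq_iff integral_iff)
      qed
    qed (simp add: zero closed)
    show "Group.monoid ?L"
    proof (rule Group.monoidI)
      fix x y z assume car: "x \<in> carrier ?L" "y \<in> carrier ?L" "z \<in> carrier ?L"
      from cases[OF car(1)] obtain a b where x: "x = frac R a b" "a \<in> carrier R" "b \<in> carrier R" "b \<noteq> \<zero>" by blast
      from cases[OF car(2)] obtain c d where y: "y = frac R c d" "c \<in> carrier R" "d \<in> carrier R" "d \<noteq> \<zero>" by blast
      from cases[OF car(3)] obtain e f where z: "z = frac R e f" "e \<in> carrier R" "f \<in> carrier R" "f \<noteq> \<zero>" by blast
      note xyz = x y z
      show "x \<otimes>\<^bsub>?L\<^esub> y \<in> carrier ?L" using xyz by (simp add: frac_mult closed integral_iff)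
      show "x \<otimes>\<^bsub>?L\<^esub> y \<otimes>\<^bsub>?L\<^esub> z = x \<otimes>\<^bsub>?L\<^esub> (y \<otimes>\<^bsub>?L\<^esub> z)"
        using xyz by (simp add: frac_mult integral_iff m_assoc)
      show "\<one>\<^bsub>?L\<^esub> \<otimes>\<^bsub>?L\<^esub> x = x" "x \<otimes>\<^bsub>?L\<^esub> \<one>\<^bsub>?L\<^esub> = x" using xyz by (simp_all add: one frac_mult)
    qed (simp add: one closed)
    fix x y z assume car: "x \<in> carrier ?L" "y \<in> carrier ?L" "z \<in> carrier ?L"
    from cases[OF car(1)] obtain a b where x: "x = frac R a b" "a \<in> carrier R" "b \<in> carrier R" "b \<noteq> \<zero>" by blast
    from cases[OF car(2)] obtain c d where y: "y = frac R c d" "c \<in> carrier R" "d \<in> carrier R" "d \<noteq> \<zero>" by blast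
    from cases[OF car(3)] obtain e f where z: "z = frac R e f" "e \<in> carrier R" "f \<in> carrier R" "f \<noteq> \<zero>" by blast
    note xyz = x y z
    have num: "((a \<otimes> d \<oplus> c \<otimes> b) \<otimes> e) \<otimes> ((b \<otimes> f) \<otimes> (d \<otimes> f)) =
        ((a \<otimes> e) \<otimes> (d \<otimes> f) \<oplus> (c \<otimes> e) \<otimes> (b \<otimes> f)) \<otimes> ((b \<otimes> d) \<otimes> f)"
      using xyz(2,3,6,7,10,11) by (simp add: l_distr r_distr m_ac)
    have "frac R ((a \<otimes> d \<oplus> c \<otimes> b) \<otimes> e) ((b \<otimes> d) \<otimes> f) =
        frac R ((a \<otimes> e) \<otimes> (d \<otimes> f) \<oplus> (c \<otimes> e) \<otimes> (b \<otimes> f)) ((b \<otimes> f) \<otimes> (d \<otimes> f))"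
      by (subst frac_eq_iff, simp_all only: num) (use xyz in \<open>auto simp: integral_iff\<close>)
    thus distr: "(x \<oplus>\<^bsub>?L\<^esub> y) \<otimes>\<^bsub>?L\<^esub> z = x \<otimes>\<^bsub>?L\<^esub> z \<oplus>\<^bsub>?L\<^esub> y \<otimes>\<^bsub>?L\<^esub> z"
      using xyz by (simp add: frac_add frac_mult integral_iff)
    have comm: "v \<otimes>\<^bsub>?L\<^esub> w = w \<otimes>\<^bsub>?L\<^esub> v" if "v \<in> carrier ?L" "w \<in> carrier ?L" for v w
      using cases[OF that(1)] cases[OF that(2)] by (auto simp: frac_mult m_comm)
    have "x \<in> carrier ?L" "y \<in> carrier ?L" "z \<in> carrier ?L" "x \<oplus>\<^bsub>?L\<^esub> y \<in> carrier ?L"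
      using xyz by (simp_all add: frac_add closed integral_iff)
    thus "z \<otimes>\<^bsub>?L\<^esub> (x \<oplus>\<^bsub>?L\<^esub> y) = z \<otimes>\<^bsub>?L\<^esub> x \<oplus>\<^bsub>?L\<^esub> z \<otimes>\<^bsub>?L\<^esub> y"
      using distr by (simp add: comm[of z])
  qed
qed

end

section \<open>Coordinate rings\<close>

lemma irreducible_affine_varietyD:
  fixes V :: "(nat \<Rightarrow> 'k::idom) set"
  assumes "irreducible_affine_variety d V"
  shows "V \<noteq> {}" "V \<subseteq> affine_space d" "\<exists>P \<subseteq> polyfuns d. V = zero_locus d P"
    "\<And>f g. f \<in> polyfuns d \<Longrightarrow> g \<in> polyfuns d \<Longrightarrow> (\<And>x. x \<in> V \<Longrightarrow> f x * g x = 0) \<Longrightarrow>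
      (\<forall>x\<in>V. f x = 0) \<or> (\<forall>x\<in>V. g x = 0)"
proof -
  have cl: "closedin (zariski d) V" and ir: "irreducible_space (subtopology (zariski d) V)"
    using assms by (auto simp: irreducible_affine_variety_def)
  have sub: "V \<subseteq> affine_space d" using closedin_subset[OF cl] by (simp add: topspace_zariski)
  hence top: "topspace (subtopology (zariski d) V) = V" by (simp add: topspace_zariski Int_absorb1)
  show "V \<subseteq> affine_space d" by (rule sub)
  show "V \<noteq> {}" using ir top by (simp add: irreducible_space_def)
  show "\<exists>P \<subseteq> polyfuns d. V = zero_locus d P" using cl unfolding closedin_zariski .
  fix f g :: "(nat \<Rightarrow> 'k) \<Rightarrow> 'k"
  assume fg: "f \<in> polyfuns d" "g \<in> polyfuns d" "\<And>x. x \<in> V \<Longrightarrow> f x * g x = 0"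
  have closed: "closedin (subtopology (zariski d) V) (zero_locus d {p} \<inter> V)" if "p \<in> polyfuns d" for p
    unfolding closedin_subtopology closedin_zariski
    by (rule exI[of _ "zero_locus d {p}"]) (use that in \<open>auto intro!: exI[of _ "{p}"]\<close>)
  have ir': "A = V \<or> B = V" if "closedin (subtopology (zariski d) V) A" "closedin (subtopology (zariski d) V) B"
      "A \<union> B = V" for A B
    using ir that unfolding irreducible_space_def top by blast
  have "zero_locus d {f} \<inter> V = V \<or> zero_locus d {g} \<inter> V = V"
    by (rule ir'[OF closed[OF fg(1)] closed[OF fg(2)]]) (use fg(3) sub in \<open>auto simp: zero_locus_def\<close>)
  thus "(\<forall>x\<in>V. f x = 0) \<or> (\<forall>x\<in>V. g x = 0)" by (auto simp: zero_locus_def)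
qed

lemma coordinate_ring_sel:
  "carrier (coordinate_ring d V) = (\<lambda>f. restrict f V) ` polyfuns d"
  "\<one>\<^bsub>coordinate_ring d V\<^esub> = restrict (\<lambda>_. 1) V"
  "\<zero>\<^bsub>coordinate_ring d V\<^esub> = restrict (\<lambda>_. 0) V"
  "restrict f V \<otimes>\<^bsub>coordinate_ring d V\<^esub> restrict g V = restrict (\<lambda>x. f x * g x) V"
  "restrict f V \<oplus>\<^bsub>coordinate_ring d V\<^esub> restrict g V = restrict (\<lambda>x. f x + g x) V"
  by (auto simp: coordinate_ring_def)

lemma restrict_eq_iff: "restrict f V = restrict g V \<longleftrightarrow> (\<forall>x\<in>V. f x = g x)"
  by (metis restrict_apply' restrict_ext)

lemma domain_coordinate_ring:
  fixes V :: "(nat \<Rightarrow> 'k::idom) set"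
  assumes V: "irreducible_affine_variety d V"
  shows "domain (coordinate_ring d V)"
proof -
  interpret fun_algebra "polyfuns d :: ((nat \<Rightarrow> 'k) \<Rightarrow> 'k) set" by (rule fun_algebra_polyfuns)
  let ?A = "coordinate_ring d V"
  have "cring ?A"
  proof (rule cringI)
    show "abelian_group ?A"
    proof (rule abelian_groupI)
      fix f assume "f \<in> carrier ?A"
      then obtain p where p: "p \<in> polyfuns d" "f = restrict p V" by (auto simp: coordinate_ring_sel)
      show "\<exists>g\<in>carrier ?A. g \<oplus>\<^bsub>?A\<^esub> f = \<zero>\<^bsub>?A\<^esub>"
        by (rule bexI[of _ "restrict (\<lambda>x. - p x) V"])
           (use p uminus in \<open>auto simp: coordinate_ring_sel\<close>)
    qed (auto simp: coordinate_ring_sel restrict_eq_iff algebra_simps intro!: add const imageI)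
    show "comm_monoid ?A"
      by (rule comm_monoidI) (auto simp: coordinate_ring_sel restrict_eq_iff algebra_simps intro!: mult const imageI)
  qed (auto simp: coordinate_ring_sel restrict_eq_iff algebra_simps)
  moreover have "domain_axioms ?A"
  proof
    show "\<one>\<^bsub>?A\<^esub> \<noteq> \<zero>\<^bsub>?A\<^esub>"
      using irreducible_affine_varietyD(1)[OF V] by (auto simp: coordinate_ring_sel restrict_eq_iff)
    fix f g assume "f \<otimes>\<^bsub>?A\<^esub> g = \<zero>\<^bsub>?A\<^esub>" "f \<in> carrier ?A" "g \<in> carrier ?A"
    then obtain p q where pq: "p \<in> polyfuns d" "f = restrict p V" "q \<in> polyfuns d" "g = restrict q V"
        "\<And>x. x \<in> V \<Longrightarrow> p x * q x = 0" by (auto simp: coordinate_ring_sel restrict_eq_iff)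
    show "f = \<zero>\<^bsub>?A\<^esub> \<or> g = \<zero>\<^bsub>?A\<^esub>"
      using irreducible_affine_varietyD(4)[OF V pq(1,3,5)]
      by (simp add: coordinate_ring_sel restrict_eq_iff pq(2,4))
  qed
  ultimately show ?thesis by (rule domain.intro)
qed

text \<open>Over a normal variety, a quotient of regular functions which satisfies a monic equation over the
  regular functions is itself regular. The equation need only hold where the denominator does not
  vanish.\<close>

lemma normal_variety_dvd:
  fixes W :: "(nat \<Rightarrow> 'k::field) set"
  assumes W: "irreducible_affine_variety e W" and normal: "normal_variety e W"
    and a: "a \<in> polyfuns e" and s: "s \<in> polyfuns e" and y0: "y0 \<in> W" "s y0 \<noteq> 0"
    and Q: "Q \<in> poly_family (polyfuns e)" "\<And>y. Polynomial.lead_coeff (Q y) = 1" "\<And>y. Polynomial.degree (Q y) = n"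
    and root: "\<And>y. y \<in> W \<Longrightarrow> s y \<noteq> 0 \<Longrightarrow> poly (Q y) (a y / s y) = 0"
  obtains b where "b \<in> polyfuns e" "\<And>y. y \<in> W \<Longrightarrow> a y = s y * b y"
proof -
  interpret P: fun_algebra "polyfuns e :: ((nat \<Rightarrow> 'k) \<Rightarrow> 'k) set" by (rule fun_algebra_polyfuns)
  define A where "A = coordinate_ring e W"
  define L where "L = fraction_field A"
  interpret A: domain A unfolding A_def by (rule domain_coordinate_ring[OF W])
  interpret L: ring L unfolding L_def by (rule A.ring_fraction_field)
  note sel = coordinate_ring_sel[of e W, folded A_def]
  let ?r = "\<lambda>f. restrict f W"
  let ?q = "\<lambda>i y. Polynomial.coeff (Q y) i"
  have q: "?q i \<in> polyfuns e" for i by (rule P.family_coeff[OF Q(1)])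
  have car: "?r f \<in> carrier A" if "f \<in> polyfuns e" for f using that by (simp add: sel)
  have spow: "(\<lambda>y. s y ^ k) \<in> polyfuns e" for k by (rule P.power[OF s])
  have spow0: "?r (\<lambda>y. s y ^ k) \<noteq> \<zero>\<^bsub>A\<^esub>" for k
    using y0 by (auto simp: sel restrict_eq_iff)
  define x where "x = frac A (?r a) (?r s)"
  have xL: "x \<in> carrier L"
    using car[OF a] car[OF s] spow0[of 1] by (auto simp: L_def A.carrier_fraction_field x_def)
  have xpow: "x [^]\<^bsub>L\<^esub> k = frac A (?r (\<lambda>y. a y ^ k)) (?r (\<lambda>y. s y ^ k))" for k
  proof (induction k)
    case 0
    have "?r (\<lambda>y. a y ^ 0) = \<one>\<^bsub>A\<^esub>" "?r (\<lambda>y. s y ^ 0) = \<one>\<^bsub>A\<^esub>" by (simp_all only: sel power_0)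
    thus ?case by (simp only: L.nat_pow_0) (simp add: L_def fraction_field_def)
  next
    case (Suc k)
    have "x [^]\<^bsub>L\<^esub> Suc k = frac A (?r (\<lambda>y. a y ^ k)) (?r (\<lambda>y. s y ^ k)) \<otimes>\<^bsub>L\<^esub> x"
      by (simp only: L.nat_pow_Suc Suc.IH)
    also have "\<dots> = frac A (?r (\<lambda>y. a y ^ k) \<otimes>\<^bsub>A\<^esub> ?r a) (?r (\<lambda>y. s y ^ k) \<otimes>\<^bsub>A\<^esub> ?r s)"
      unfolding x_def L_def
      by (rule A.frac_mult) (use car P.power[OF a] spow spow0 spow0[of 1] a s in auto)
    finally show ?case by (simp only: sel power_Suc2)
  qed
  let ?F = "\<lambda>i. frac_incl A (?r (?q i))"
  \<comment> \<open>The partial sums of the equation in the fraction field, with denominator \<open>s ^ k\<close>.\<close>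
  have eval: "\<exists>N\<in>polyfuns e. ring.eval L (map ?F (rev [0..<k])) x = frac A (?r N) (?r (\<lambda>y. s y ^ k)) \<and>
      (\<forall>y\<in>W. s y \<noteq> 0 \<longrightarrow> N y = s y ^ k * (\<Sum>i<k. ?q i y * (a y / s y) ^ i))" for k
  proof (induction k)
    case 0
    have "\<zero>\<^bsub>L\<^esub> = frac A \<zero>\<^bsub>A\<^esub> \<one>\<^bsub>A\<^esub>" by (simp add: L_def fraction_field_def)
    moreover have "?r (\<lambda>y. s y ^ 0) = \<one>\<^bsub>A\<^esub>" "?r (\<lambda>_. 0) = \<zero>\<^bsub>A\<^esub>" by (simp_all only: sel power_0)
    ultimately have ev: "ring.eval L (map ?F (rev [0..<0])) x = frac A (?r (\<lambda>_. 0)) (?r (\<lambda>y. s y ^ 0))"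
      by (simp only: upt_0 rev.simps list.map L.eval.simps)
    show ?case
      by (rule bexI[of _ "\<lambda>_. 0"], rule conjI, rule ev) (simp_all add: P.const)
  next
    case (Suc k)
    then obtain N where N: "N \<in> polyfuns e"
        "ring.eval L (map ?F (rev [0..<k])) x = frac A (?r N) (?r (\<lambda>y. s y ^ k))"
        "\<And>y. y \<in> W \<Longrightarrow> s y \<noteq> 0 \<Longrightarrow> N y = s y ^ k * (\<Sum>i<k. ?q i y * (a y / s y) ^ i)" by blast
    let ?N' = "\<lambda>y. (?q k y * a y ^ k + N y) * s y"
    have N': "?N' \<in> polyfuns e" by (intro P.add P.mult P.power q a s N)
    have qa: "(\<lambda>y. ?q k y * a y ^ k) \<in> polyfuns e" by (intro P.mult P.power q a)
    have "ring.eval L (map ?F (rev [0..<Suc k])) x =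
        ?F k \<otimes>\<^bsub>L\<^esub> (x [^]\<^bsub>L\<^esub> k) \<oplus>\<^bsub>L\<^esub> frac A (?r N) (?r (\<lambda>y. s y ^ k))"
      using N(2) by simp
    also have "?F k \<otimes>\<^bsub>L\<^esub> (x [^]\<^bsub>L\<^esub> k) = frac A (?r (?q k) \<otimes>\<^bsub>A\<^esub> ?r (\<lambda>y. a y ^ k)) (\<one>\<^bsub>A\<^esub> \<otimes>\<^bsub>A\<^esub> ?r (\<lambda>y. s y ^ k))"
      unfolding frac_incl_def xpow unfolding L_def
      by (rule A.frac_mult) (use car P.power[OF a] spow spow0 q in auto)
    also have "\<dots> = frac A (?r (\<lambda>y. ?q k y * a y ^ k)) (?r (\<lambda>y. s y ^ k))"
      by (simp add: sel)
    also have "\<dots> \<oplus>\<^bsub>L\<^esub> frac A (?r N) (?r (\<lambda>y. s y ^ k)) =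
        frac A (?r (\<lambda>y. ?q k y * a y ^ k) \<otimes>\<^bsub>A\<^esub> ?r (\<lambda>y. s y ^ k) \<oplus>\<^bsub>A\<^esub> ?r N \<otimes>\<^bsub>A\<^esub> ?r (\<lambda>y. s y ^ k))
          (?r (\<lambda>y. s y ^ k) \<otimes>\<^bsub>A\<^esub> ?r (\<lambda>y. s y ^ k))"
      unfolding L_def by (rule A.frac_add) (use car spow spow0 qa N(1) in auto)
    also have "\<dots> = frac A (?r ?N') (?r (\<lambda>y. s y ^ Suc k))"
    proof (subst A.frac_eq_iff)
      show "?r (\<lambda>y. s y ^ k) \<otimes>\<^bsub>A\<^esub> ?r (\<lambda>y. s y ^ k) \<noteq> \<zero>\<^bsub>A\<^esub>"
        using A.integral[of "?r (\<lambda>y. s y ^ k)" "?r (\<lambda>y. s y ^ k)"] spow0[of k] car[OF spow] by blast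
      show "(?r (\<lambda>y. ?q k y * a y ^ k) \<otimes>\<^bsub>A\<^esub> ?r (\<lambda>y. s y ^ k) \<oplus>\<^bsub>A\<^esub> ?r N \<otimes>\<^bsub>A\<^esub> ?r (\<lambda>y. s y ^ k))
          \<otimes>\<^bsub>A\<^esub> ?r (\<lambda>y. s y ^ Suc k) = ?r ?N' \<otimes>\<^bsub>A\<^esub> (?r (\<lambda>y. s y ^ k) \<otimes>\<^bsub>A\<^esub> ?r (\<lambda>y. s y ^ k))"
        by (simp only: sel restrict_eq_iff) (simp add: algebra_simps)
    qed (use car[OF qa] car[OF spow] car[OF N(1)] car[OF N'] car[OF spow[of "Suc k"]] spow0[of "Suc k"] in auto)
    finally have ev: "ring.eval L (map ?F (rev [0..<Suc k])) x = frac A (?r ?N') (?r (\<lambda>y. s y ^ Suc k))" .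
    show ?case
    proof (rule bexI[OF _ N'], intro conjI ballI impI ev)
      fix y assume y: "y \<in> W" "s y \<noteq> 0"
      have "s y ^ k * (a y / s y) ^ k = a y ^ k" using y by (simp add: power_divide)
      thus "?N' y = s y ^ Suc k * (\<Sum>i<Suc k. ?q i y * (a y / s y) ^ i)"
        using N(3)[OF y] by (simp add: algebra_simps)
    qed
  qed
  obtain N where N: "N \<in> polyfuns e"
      "ring.eval L (map ?F (rev [0..<Suc n])) x = frac A (?r N) (?r (\<lambda>y. s y ^ Suc n))"
      "\<And>y. y \<in> W \<Longrightarrow> s y \<noteq> 0 \<Longrightarrow> N y = s y ^ Suc n * (\<Sum>i<Suc n. ?q i y * (a y / s y) ^ i)"
    using eval[of "Suc n"] by blast
  have "N y * s y = 0" if "y \<in> W" for y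
  proof (cases "s y = 0")
    case False
    have "(\<Sum>i<Suc n. ?q i y * (a y / s y) ^ i) = poly (Q y) (a y / s y)"
      using Q(3)[of y] by (simp only: poly_altdef lessThan_Suc_atMost)
    thus ?thesis using N(3)[OF that False] root[OF that False] by simp
  qed simp
  hence N0: "\<forall>y\<in>W. N y = 0"
    using irreducible_affine_varietyD(4)[OF W N(1) s] y0 by blast
  have "ring.eval L (map ?F (rev [0..<Suc n])) x = \<zero>\<^bsub>L\<^esub>"
  proof -
    have "frac A (?r N) (?r (\<lambda>y. s y ^ Suc n)) = frac A \<zero>\<^bsub>A\<^esub> \<one>\<^bsub>A\<^esub>"
    proof (subst A.frac_eq_iff)
      show "?r N \<otimes>\<^bsub>A\<^esub> \<one>\<^bsub>A\<^esub> = \<zero>\<^bsub>A\<^esub> \<otimes>\<^bsub>A\<^esub> ?r (\<lambda>y. s y ^ Suc n)"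
        using N0 by (simp only: sel restrict_eq_iff) simp
    qed (use car[OF N(1)] car[OF spow[of "Suc n"]] spow0[of "Suc n"] in auto)
    thus ?thesis unfolding N(2) by (simp add: L_def fraction_field_def)
  qed
  moreover have "map ?F (rev [0..<Suc n]) \<in> carrier ((frac_incl A ` carrier A)[X]\<^bsub>L\<^esub>)"
    "map ?F (rev [0..<Suc n]) \<noteq> []" "hd (map ?F (rev [0..<Suc n])) = \<one>\<^bsub>L\<^esub>"
  proof -
    have "?r (?q n) = \<one>\<^bsub>A\<^esub>"
      using Q(2,3) by (simp add: sel)
    thus hd: "hd (map ?F (rev [0..<Suc n])) = \<one>\<^bsub>L\<^esub>"
      by (simp add: frac_incl_def L_def fraction_field_def)
    have "\<one>\<^bsub>L\<^esub> \<noteq> \<zero>\<^bsub>L\<^esub>"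
      by (simp add: L_def fraction_field_def A.frac_eq_iff)
    thus "map ?F (rev [0..<Suc n]) \<in> carrier ((frac_incl A ` carrier A)[X]\<^bsub>L\<^esub>)"
      using hd car[OF q] unfolding univ_poly_def polynomial_def by auto
  qed simp
  ultimately have "integral_over L (frac_incl A ` carrier A) x"
    unfolding integral_over_def by blast
  hence "x \<in> frac_incl A ` carrier A"
    using normal xL unfolding normal_variety_def integrally_closed_def A_def L_def by blast
  then obtain b where b: "b \<in> polyfuns e" "frac A (?r a) (?r s) = frac A (?r b) \<one>\<^bsub>A\<^esub>"
    unfolding x_def frac_incl_def by (auto simp: sel)
  have "?r a \<otimes>\<^bsub>A\<^esub> \<one>\<^bsub>A\<^esub> = ?r b \<otimes>\<^bsub>A\<^esub> ?r s"
    using b(2) by (subst (asm) A.frac_eq_iff) (use car[OF a] car[OF s] car[OF b(1)] spow0[of 1] in auto)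
  hence "\<forall>y\<in>W. a y = b y * s y" by (simp add: sel restrict_eq_iff)
  thus thesis using that[OF b(1)] by (simp add: mult.commute)
qed

lemma finite_morphism_extension:
  fixes V W :: "(nat \<Rightarrow> 'k::field) set"
  assumes V: "irreducible_affine_variety d V" and u: "finite_morphism d V e W u"
  obtains S where "finite_extension (polyfuns e) u V S" "polyfuns d \<subseteq> rspan (polyfuns e) u V S"
proof -
  interpret R: fun_algebra "polyfuns e :: ((nat \<Rightarrow> 'k) \<Rightarrow> 'k) set" by (rule fun_algebra_polyfuns)
  define B where "B = coordinate_ring d V"
  interpret B: domain B unfolding B_def by (rule domain_coordinate_ring[OF V])
  define K where "K = comorphism V u ` carrier (coordinate_ring e W)"
  have uVW: "u \<in> V \<rightarrow> W" using u by (simp add: finite_morphism_def variety_morphism_def)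
  obtain gs where gs: "set gs \<subseteq> carrier B" "ring.Span B K gs = carrier B"
    using u unfolding finite_morphism_def B_def K_def by blast
  have Span: "f \<in> rspan (polyfuns e) u V (set gs')" if "f \<in> ring.Span B K gs'" for f gs'
    using that
  proof (induction gs' arbitrary: f)
    case Nil
    hence "f = \<zero>\<^bsub>B\<^esub>" by simp
    hence "f = restrict (\<lambda>_. 0) V" by (simp add: B_def coordinate_ring_sel)
    thus ?case by (auto intro: rspan.zero)
  next
    case (Cons g gs')
    then obtain k v where kv: "k \<in> K" "v \<in> ring.Span B K gs'" "f = k \<otimes>\<^bsub>B\<^esub> g \<oplus>\<^bsub>B\<^esub> v"
      by (auto simp: B.line_extension_mem_iff)
    then obtain q where q: "q \<in> polyfuns e" "k = compose V (restrict q W) u"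
      by (auto simp: K_def comorphism_def coordinate_ring_sel)
    have v: "v \<in> rspan (polyfuns e) u V (set (g # gs'))"
      using Cons.IH[OF kv(2)] rspan_mono[of "polyfuns e" "polyfuns e" "set gs'" "set (g # gs')" u V] by auto
    show ?case
      by (rule rspan.step[OF q(1) _ v, of g])
         (use uVW in \<open>auto simp: kv(3) B_def coordinate_ring_def q(2) compose_def\<close>)
  qed
  have B: "f \<in> rspan (polyfuns e) u V (set gs)" if "f \<in> carrier B" for f
    using Span that gs(2) by blast
  have poly: "f \<in> rspan (polyfuns e) u V (set gs)" if "f \<in> polyfuns d" for f
    by (rule rspan_cong[OF B, of "restrict f V"]) (use that in \<open>auto simp: B_def coordinate_ring_sel\<close>)
  show thesis
  proof
    show "polyfuns d \<subseteq> rspan (polyfuns e) u V (set gs)" using poly by blast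
    show "finite_extension (polyfuns e) u V (set gs)"
    proof
      show "(\<lambda>_. 1) \<in> rspan (polyfuns e) u V (set gs)" by (rule poly) (rule polyfuns.const)
      fix g g' assume g: "g \<in> set gs" "g' \<in> set gs"
      hence "g \<otimes>\<^bsub>B\<^esub> g' \<in> carrier B" using gs(1) by auto
      from B[OF this] show "(\<lambda>x. g x * g' x) \<in> rspan (polyfuns e) u V (set gs)"
        by (rule rspan_cong) (simp add: B_def coordinate_ring_def)
    qed simp
  qed
qed

section \<open>Polynomials with many distinct roots\<close>

lemma infinite_UNIV_alg_closed: "infinite (UNIV :: 'k::alg_closed_field set)"
proof
  assume fin: "finite (UNIV :: 'k set)"
  let ?p = "(\<Prod>a\<in>UNIV. [:- a, 1:]) + 1 :: 'k poly"
  have "poly (\<Prod>a\<in>(UNIV :: 'k set). [:- a, 1:]) x = 0" for x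
    using fin by (auto simp: poly_prod prod_zero_iff)
  hence no_root: "poly ?p x \<noteq> 0" for x by simp
  have "Polynomial.degree (\<Prod>a\<in>(UNIV :: 'k set). [:- a, 1:]) = card (UNIV :: 'k set)"
    by (subst degree_prod_eq_sum_degree) auto
  moreover have "card (UNIV :: 'k set) > 0" using fin by (simp add: card_gt_0_iff)
  ultimately have "Polynomial.degree ?p > 0" by (subst degree_add_eq_left) auto
  thus False using alg_closed_imp_poly_has_root no_root by blast
qed

text \<open>A linear form with coefficients \<open>1, t, t\<^sup>2, \<dots>\<close> separates finitely many points unless \<open>t\<close> is
  one of the finitely many roots of certain nonzero polynomials.\<close>

lemma separating_polyfun:
  fixes F :: "(nat \<Rightarrow> 'k::alg_closed_field) set"
  assumes F: "finite F" "F \<subseteq> affine_space d"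
  obtains f where "f \<in> polyfuns d" "inj_on f F"
proof -
  define p where "p = (\<lambda>(x, x'). \<Sum>i<d. Polynomial.monom (x i - x' i :: 'k) i)"
  have coeff_p: "Polynomial.coeff (p (x, x')) i = x i - x' i" if "i < d" for x x' i
    using that by (simp add: p_def coeff_sum)
  have p0: "p (x, x') \<noteq> 0" if "x \<in> F" "x' \<in> F" "x \<noteq> x'" for x x'
  proof
    assume "p (x, x') = 0"
    hence "x i = x' i" if "i < d" for i using coeff_p[OF that, of x x'] by simp
    moreover have "x \<in> affine_space d" "x' \<in> affine_space d" using that F by auto
    ultimately have "x = x'" unfolding affine_space_def by (intro PiE_ext) auto
    thus False using that by simp
  qed
  let ?B = "\<Union>q \<in> F \<times> F - Id. {t. poly (p q) t = 0}"
  have "finite ?B"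
    using F p0 by (intro finite_UN_I) (auto intro!: poly_roots_finite)
  then obtain t where t: "t \<notin> ?B"
    using ex_new_if_finite[OF infinite_UNIV_alg_closed] by metis
  let ?f = "\<lambda>x :: nat \<Rightarrow> 'k. \<Sum>i<d. t ^ i * x i"
  interpret fun_algebra "polyfuns d :: ((nat \<Rightarrow> 'k) \<Rightarrow> 'k) set" by (rule fun_algebra_polyfuns)
  show thesis
  proof
    show "?f \<in> polyfuns d" by (intro sum mult const polyfuns.coord) auto
    show "inj_on ?f F"
    proof (rule inj_onI, rule ccontr)
      fix x x' assume x: "x \<in> F" "x' \<in> F" "?f x = ?f x'" "x \<noteq> x'"
      have "poly (p (x, x')) t = ?f x - ?f x'"
        by (simp add: p_def poly_sum poly_monom sum_subtractf algebra_simps)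
      thus False using t x by auto
    qed
  qed
qed

lemma monic_factorization:
  fixes p :: "'k::alg_closed_field poly"
  assumes "Polynomial.lead_coeff p = 1" "Polynomial.degree p = r"
  obtains \<tau> :: "nat \<Rightarrow> 'k" where "p = (\<Prod>l<r. [:- \<tau> l, 1:])"
proof -
  obtain A where A: "size A = r" "p = (\<Prod>x\<in>#A. [:- x, 1:])"
    using alg_closed_imp_factorization[of p] assms by fastforce
  obtain xs where xs: "mset xs = A" using ex_mset by blast
  have "p = prod_list (map (\<lambda>x. [:- x, 1:]) xs)"
    unfolding A(2) xs[symmetric] by (simp only: prod_mset_prod_list mset_map[symmetric])
  also have "\<dots> = (\<Prod>l<length xs. [:- (xs ! l), 1:])"
    by (simp add: prod.list_conv_set_nth lessThan_atLeast0)
  finally show thesis using that[of "\<lambda>l. xs ! l"] xs A(1) by (metis size_mset)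
qed

lemma roots_prod_linear:
  fixes r :: nat
  shows "{c :: 'k::idom. poly (\<Prod>l<r. [:- \<tau> l, 1:]) c = 0} = \<tau> ` {..<r}"
  by (auto simp: poly_prod prod_zero_iff)

text \<open>The points where a monic polynomial of degree \<open>r\<close> has fewer than \<open>m\<close> distinct roots are the
  image of a closed set under the finite map which forgets the tuple of all \<open>r\<close> roots. Unlike a
  discriminant criterion, this works in any characteristic.\<close>

lemma many_roots_open:
  fixes W :: "(nat \<Rightarrow> 'k::alg_closed_field) set"
  assumes P: "P \<in> poly_family (polyfuns e)" and monic: "\<And>y. Polynomial.lead_coeff (P y) = 1"
      "\<And>y. Polynomial.degree (P y) = r"
    and y0: "card {c. poly (P y0) c = 0} \<ge> m"
  obtains s where "s \<in> polyfuns e" "s y0 \<noteq> 0" "\<And>y. y \<in> W \<Longrightarrow> s y \<noteq> 0 \<Longrightarrow> card {c. poly (P y) c = 0} \<ge> m"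
proof -
  interpret R: fun_algebra "polyfuns e :: ((nat \<Rightarrow> 'k) \<Rightarrow> 'k) set" by (rule fun_algebra_polyfuns)
  interpret T: fun_algebra "polyfuns r :: ((nat \<Rightarrow> 'k) \<Rightarrow> 'k) set" by (rule fun_algebra_polyfuns)
  have "\<exists>s\<in>polyfuns e. s y0 \<noteq> 0 \<and> (\<forall>y\<in>W. s y \<noteq> 0 \<longrightarrow> card {c. poly (P y) c = 0} \<ge> m)"
  proof (rule ccontr)
    assume contr: "\<not> ?thesis"
    define Y where "Y = {(y, \<tau>). y \<in> W \<and> P y = (\<Prod>l<r. [:- \<tau> l, 1:]) \<and> card (\<tau> ` {..<r}) < m}"
    have "poly (P (fst x)) (snd x l) = 0" if "x \<in> Y" "l < r" for x l
      using that by (auto simp: Y_def poly_prod prod_zero_iff)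
    from adjoin_roots[OF R.fun_algebra_axioms P monic, of Y r fst "\<lambda>l x. snd x l", OF this]
    obtain S where S: "finite_extension (polyfuns e) fst Y S"
        "\<And>l. l < r \<Longrightarrow> (\<lambda>x. snd x l) \<in> rspan (polyfuns e) fst Y S" by blast
    have closure: "\<rho> y0 = 0" if \<rho>: "\<rho> \<in> polyfuns e" "\<And>x. x \<in> Y \<Longrightarrow> \<rho> (fst x) = 0" for \<rho>
    proof (rule ccontr)
      assume "\<rho> y0 \<noteq> 0"
      with contr \<rho>(1) obtain y where y: "y \<in> W" "\<rho> y \<noteq> 0" "card {c. poly (P y) c = 0} < m"
        by (meson not_le)
      obtain \<tau> where \<tau>: "P y = (\<Prod>l<r. [:- \<tau> l, 1:])" using monic_factorization[OF monic] by blast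
      hence "(y, \<tau>) \<in> Y" using y by (auto simp: Y_def roots_prod_linear)
      from \<rho>(2)[OF this] y(2) show False by simp
    qed
    obtain \<xi> where "\<xi> \<in> affine_space r" and \<xi>: "\<And>b \<rho>. b \<in> polyfuns r \<Longrightarrow> \<rho> \<in> polyfuns e \<Longrightarrow>
        (\<And>x. x \<in> Y \<Longrightarrow> b (snd x) = \<rho> (fst x)) \<Longrightarrow> b \<xi> = \<rho> y0"
    proof (rule finite_image_closed[where c = snd and D = r and z = y0, OF S(1)])
      show "(\<lambda>x. snd x i) \<in> rspan (polyfuns e) fst Y S" if "i < r" for i
        using that by (rule S(2))
      show "\<rho> y0 = 0" if "\<rho> \<in> polyfuns e" "\<And>x. x \<in> Y \<Longrightarrow> \<rho> (fst x) = 0" for \<rho>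
        using that by (rule closure)
      fix \<xi> assume \<xi>: "\<xi> \<in> affine_space r" "\<And>b \<rho>. b \<in> polyfuns r \<Longrightarrow> \<rho> \<in> polyfuns e \<Longrightarrow>
          (\<And>x. x \<in> Y \<Longrightarrow> b (snd x) = \<rho> (fst x)) \<Longrightarrow> b \<xi> = \<rho> y0"
      show thesis
      proof (rule that[OF \<xi>(1)])
        fix b \<rho> assume "b \<in> polyfuns r" "\<rho> \<in> polyfuns e" and eq: "\<And>x. x \<in> Y \<Longrightarrow> b (snd x) = \<rho> (fst x)"
        thus "b \<xi> = \<rho> y0" by (rule \<xi>(2)) (simp add: eq)
      qed
    qed
    have "P y0 = (\<Prod>l<r. [:- \<xi> l, 1:])"
    proof (rule poly_eqI)
      fix i
      have "(\<lambda>\<tau>. \<Prod>l<r. [:- \<tau> l, 1:]) \<in> poly_family (polyfuns r :: ((nat \<Rightarrow> 'k) \<Rightarrow> 'k) set)"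
        by (intro T.family_prod T.family_linear polyfuns.coord) auto
      from \<xi>[OF T.family_coeff[OF this, of i] R.family_coeff[OF P, of i]]
      show "Polynomial.coeff (P y0) i = Polynomial.coeff (\<Prod>l<r. [:- \<xi> l, 1:]) i"
        by (auto simp: Y_def)
    qed
    hence "m \<le> card (\<xi> ` {..<r})" using y0 by (simp add: roots_prod_linear)
    then obtain C where "C \<subseteq> \<xi> ` {..<r}" "card C = m"
      using obtain_subset_with_card_n by metis
    then obtain I where I: "I \<subseteq> {..<r}" "inj_on \<xi> I" "card I = m"
      by (auto simp: subset_image_inj card_image)
    have fin: "finite I" using I(1) finite_subset by blast
    \<comment> \<open>Tuples with fewer than \<open>m\<close> distinct values are zeros of the following product, while \<open>\<xi>\<close> is not.\<close>
    let ?b = "\<lambda>\<tau> :: nat \<Rightarrow> 'k. \<Prod>(i, j)\<in>I \<times> I - Id. \<tau> i - \<tau> j"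
    have "?b \<xi> = 0"
    proof (rule \<xi>[of ?b "\<lambda>_. 0"])
      show "?b \<in> polyfuns r"
        unfolding case_prod_beta by (intro T.prod T.diff polyfuns.coord) (use I in auto)
      show "(\<lambda>_. 0 :: 'k) \<in> polyfuns e" by (rule R.const)
      fix x assume "x \<in> Y"
      hence "card (snd x ` {..<r}) < m" by (auto simp: Y_def)
      moreover have "card (snd x ` I) \<le> card (snd x ` {..<r})"
        using I(1) by (intro card_mono) auto
      ultimately have "\<not> inj_on (snd x) I" using I(3) card_image by fastforce
      then obtain i j where "i \<in> I" "j \<in> I" "i \<noteq> j" "snd x i = snd x j" by (auto simp: inj_on_def)
      thus "?b (snd x) = 0" using fin by (auto simp: prod_zero_iff intro!: bexI[of _ "(i, j)"])
    qed
    moreover have "finite (I \<times> I - Id)" using fin by blast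
    ultimately obtain p where p: "p \<in> I \<times> I - Id" "(case p of (i, j) \<Rightarrow> \<xi> i - \<xi> j) = 0"
      using prod_zero_iff by blast
    hence "\<xi> (fst p) = \<xi> (snd p)" "fst p \<in> I" "snd p \<in> I" "fst p \<noteq> snd p" by auto
    thus False using inj_onD[OF I(2)] by blast
  qed
  thus thesis using that by blast
qed

section \<open>The minimal polynomial of a regular function\<close>

text \<open>Division of \<open>F\<close> by \<open>q\<close> after multiplication with a power of the coefficient of \<open>q\<close> at \<open>T ^ r\<close>, where
  \<open>q\<close> has degree at most \<open>r\<close> over \<open>W\<close>. The coefficient may vanish at some points.\<close>

lemma (in fun_algebra) pseudo_division:
  assumes q: "q \<in> poly_family R" "\<And>y i. y \<in> W \<Longrightarrow> i > r \<Longrightarrow> Polynomial.coeff (q y) i = 0"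
    and F: "F \<in> poly_family R"
  shows "\<exists>N. \<exists>b\<in>poly_family R. \<exists>rem\<in>poly_family R. \<forall>y\<in>W.
      Polynomial.smult (Polynomial.coeff (q y) r ^ N) (F y) = q y * b y + rem y \<and>
      (\<forall>i\<ge>r. Polynomial.coeff (rem y) i = 0)"
proof -
  let ?s = "\<lambda>y. Polynomial.coeff (q y) r"
  let ?D = "\<lambda>F. \<exists>N. \<exists>b\<in>poly_family R. \<exists>rem\<in>poly_family R. \<forall>y\<in>W.
      Polynomial.smult (?s y ^ N) (F y) = q y * b y + rem y \<and> (\<forall>i\<ge>r. Polynomial.coeff (rem y) i = 0)"
  have division: "?D F"
    if "F \<in> poly_family R" "\<And>y i. y \<in> W \<Longrightarrow> i \<ge> n \<Longrightarrow> Polynomial.coeff (F y) i = 0" for n F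
    using that
  proof (induction n arbitrary: F)
    case 0
    show ?case
      by (rule exI[of _ 0], rule bexI[of _ "\<lambda>_. 0"], rule bexI[of _ F])
         (use 0 family_const in auto)
  next
    case (Suc n)
    show ?case
    proof (cases "n < r")
      case True
      show ?thesis
        by (rule exI[of _ 0], rule bexI[of _ "\<lambda>_. 0"], rule bexI[of _ F])
           (use True Suc.prems family_const in auto)
    next
      case False
      let ?m = "\<lambda>y. Polynomial.monom (Polynomial.coeff (F y) n) (n - r)"
      let ?F' = "\<lambda>y. [:?s y:] * F y - ?m y * q y"
      have s: "?s \<in> R" by (rule family_coeff[OF q(1)])
      have m: "?m \<in> poly_family R" by (rule family_monom[OF family_coeff[OF Suc.prems(1)]])
      have F': "?F' \<in> poly_family R"
        by (intro family_diff family_mult family_pCons0 s Suc.prems(1) m q(1))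
      have high: "Polynomial.coeff (?F' y) i = 0" if "y \<in> W" "i \<ge> n" for y i
        using Suc.prems(2)[OF that(1)] q(2)[OF that(1)] that(2) False
        by (cases "i = n") (auto simp: coeff_monom_mult)
      have "?D ?F'" by (rule Suc.IH[OF F']) (erule (1) high)
      then obtain N b rem where IH: "b \<in> poly_family R" "rem \<in> poly_family R"
          "\<forall>y\<in>W. Polynomial.smult (?s y ^ N) (?F' y) = q y * b y + rem y \<and>
            (\<forall>i\<ge>r. Polynomial.coeff (rem y) i = 0)"
        by (elim exE bexE)
      let ?b = "\<lambda>y. b y + [:?s y ^ N:] * ?m y"
      show ?thesis
      proof (rule exI[of _ "Suc N"], rule bexI[of _ ?b], rule bexI[of _ rem], intro ballI conjI)
        show "?b \<in> poly_family R"
          by (intro family_add family_mult family_pCons0 power s m IH)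
        fix y assume y: "y \<in> W"
        have "Polynomial.smult (?s y ^ N) (?F' y) = q y * b y + rem y" using IH(3) y by blast
        thus "Polynomial.smult (?s y ^ Suc N) (F y) = q y * ?b y + rem y"
          by (simp add: algebra_simps smult_diff_right smult_add_right)
        show "\<forall>i\<ge>r. Polynomial.coeff (rem y) i = 0" using IH(3) y by blast
      qed (rule IH(2))
    qed
  qed
  obtain n where n: "\<And>y. Polynomial.degree (F y) \<le> n" using family_bound[OF F] by blast
  show "?D F"
    by (rule division[OF F, of "Suc n"], rule coeff_eq_0, rule le_less_trans[OF n], simp)
qed

text \<open>A finite dominant morphism of irreducible affine varieties with normal target.\<close>

locale finite_normal_cover =
  fixes V W :: "(nat \<Rightarrow> 'k::alg_closed_field) set" and u :: "(nat \<Rightarrow> 'k) \<Rightarrow> (nat \<Rightarrow> 'k)" and d e :: nat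
  assumes V: "irreducible_affine_variety d V" and W: "irreducible_affine_variety e W"
    and u: "finite_morphism d V e W u" and dominant: "dominant V e W u" and normal: "normal_variety e W"
begin

sublocale VV: fun_algebra "polyfuns d :: ((nat \<Rightarrow> 'k) \<Rightarrow> 'k) set" by (rule fun_algebra_polyfuns)
sublocale WW: fun_algebra "polyfuns e :: ((nat \<Rightarrow> 'k) \<Rightarrow> 'k) set" by (rule fun_algebra_polyfuns)

lemma maps_to: "x \<in> V \<Longrightarrow> u x \<in> W"
  using u by (auto simp: finite_morphism_def variety_morphism_def)

lemma coordinate_pullback:
  assumes "i < e"
  obtains b where "b \<in> polyfuns d" "\<And>x. x \<in> V \<Longrightarrow> b x = u x i"
proof -
  have "(\<lambda>x\<in>V. u x i) \<in> carrier (coordinate_ring d V)"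
    using u assms by (simp add: finite_morphism_def variety_morphism_def)
  thus thesis using that by (auto simp: coordinate_ring_sel restrict_eq_iff)
qed

lemma pullback:
  assumes "q \<in> polyfuns e"
  shows "\<exists>b\<in>polyfuns d. \<forall>x\<in>V. b x = q (u x)"
  using assms
proof (induction rule: polyfuns.induct)
  case (const c)
  thus ?case by (intro bexI[of _ "\<lambda>_. c"]) (auto intro: polyfuns.const)
next
  case (coord i)
  thus ?case using coordinate_pullback by metis
next
  case (add f g)
  then obtain a b where "a \<in> polyfuns d" "b \<in> polyfuns d" "\<forall>x\<in>V. a x = f (u x)" "\<forall>x\<in>V. b x = g (u x)" by blast
  thus ?case by (intro bexI[of _ "\<lambda>x. a x + b x"]) (auto intro: polyfuns.add)
next
  case (mult f g)
  then obtain a b where "a \<in> polyfuns d" "b \<in> polyfuns d" "\<forall>x\<in>V. a x = f (u x)" "\<forall>x\<in>V. b x = g (u x)" by blast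
  thus ?case by (intro bexI[of _ "\<lambda>x. a x * b x"]) (auto intro: polyfuns.mult)
qed

lemma dominant_vanish:
  assumes s: "s \<in> polyfuns e" "\<And>x. x \<in> V \<Longrightarrow> s (u x) = 0" and y: "y \<in> W"
  shows "s y = 0"
proof -
  have sub: "W \<subseteq> affine_space e" by (rule irreducible_affine_varietyD(2)[OF W])
  have "closedin (subtopology (zariski e) W) (zero_locus e {s} \<inter> W)"
    unfolding closedin_subtopology closedin_zariski
    by (rule exI[of _ "zero_locus e {s}"]) (use s in \<open>auto intro!: exI[of _ "{s}"]\<close>)
  moreover have "u ` V \<subseteq> zero_locus e {s} \<inter> W"
    using s maps_to sub by (auto simp: zero_locus_def)
  ultimately have "subtopology (zariski e) W closure_of (u ` V) \<subseteq> zero_locus e {s} \<inter> W"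
    by (rule closure_of_minimal[rotated])
  thus ?thesis using y dominant by (auto simp: dominant_def zero_locus_def)
qed

text \<open>Pullbacks of functions that do not vanish identically on \<open>W\<close> are not zero divisors on \<open>V\<close>.\<close>

lemma pullback_cancel:
  assumes s: "s \<in> polyfuns e" "y \<in> W" "s y \<noteq> 0" and b: "b \<in> polyfuns d" "\<And>x. x \<in> V \<Longrightarrow> s (u x) * b x = 0"
    and x: "x \<in> V"
  shows "b x = 0"
proof -
  obtain a where a: "a \<in> polyfuns d" "\<And>x. x \<in> V \<Longrightarrow> a x = s (u x)" using pullback[OF s(1)] by blast
  have "(\<forall>x\<in>V. a x = 0) \<or> (\<forall>x\<in>V. b x = 0)"
    by (rule irreducible_affine_varietyD(4)[OF V a(1) b(1)]) (use a b in auto)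
  moreover have "\<not> (\<forall>x\<in>V. a x = 0)" using dominant_vanish[OF s(1) _ s(2)] a(2) s(3) by auto
  ultimately show ?thesis using x by blast
qed

text \<open>The polynomial \<open>P\<close> is the minimal polynomial of \<open>f\<close> over the function field of \<open>W\<close>. To see that
  its coefficients are regular, let \<open>q\<close> be an annihilating polynomial of least degree, with leading
  coefficient \<open>s\<close>. Where \<open>s\<close> does not vanish, the roots of \<open>q\<close> are among those of a monic equation of
  \<open>f\<close>. Choosing the roots at each such point gives functions, not regular in general, that are integral
  over the regular functions of \<open>W\<close>. The coefficients of \<open>q / s\<close> are polynomials in these functions, so
  they are integral as well, hence regular because \<open>W\<close> is normal.\<close>

lemma minimal_polynomial:
  assumes f: "f \<in> polyfuns d"
  obtains P r where "P \<in> poly_family (polyfuns e)" "\<And>y. Polynomial.lead_coeff (P y) = 1"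
    "\<And>y. Polynomial.degree (P y) = r" "\<And>x. x \<in> V \<Longrightarrow> poly (P (u x)) (f x) = 0"
    "\<And>F y. F \<in> poly_family (polyfuns e) \<Longrightarrow> (\<And>x. x \<in> V \<Longrightarrow> poly (F (u x)) (f x) = 0) \<Longrightarrow> y \<in> W \<Longrightarrow> P y dvd F y"
proof -
  define ann where "ann F \<longleftrightarrow> F \<in> poly_family (polyfuns e) \<and> (\<forall>x\<in>V. poly (F (u x)) (f x) = 0)" for F
  obtain S where S: "finite_extension (polyfuns e) u V S" "polyfuns d \<subseteq> rspan (polyfuns e) u V S"
    using finite_morphism_extension[OF V u] by blast
  obtain G N where G: "G \<in> poly_family (polyfuns e)" "\<And>y. Polynomial.lead_coeff (G y) = 1"
      "\<And>y. Polynomial.degree (G y) = N" "\<And>x. x \<in> V \<Longrightarrow> poly (G (u x)) (f x) = 0"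
    using finite_extension.integral_element[OF S(1), of f] S(2) f by blast
  have "ann G" using G by (simp add: ann_def)
  define candidate where "candidate n F \<longleftrightarrow> ann F \<and> (\<exists>y\<in>W. F y \<noteq> 0) \<and> (\<forall>y\<in>W. Polynomial.degree (F y) \<le> n)" for n F
  obtain y1 where y1: "y1 \<in> W" using irreducible_affine_varietyD(1)[OF W] by blast
  have "G y1 \<noteq> 0" using G(2)[of y1] by auto
  hence ex: "\<exists>F. candidate N F" using \<open>ann G\<close> G(3) y1 unfolding candidate_def by (metis order_refl)
  define r where "r = (LEAST n. \<exists>F. candidate n F)"
  obtain q where q: "candidate r q" using LeastI[of "\<lambda>n. \<exists>F. candidate n F", OF ex] unfolding r_def by blast
  \<comment> \<open>By minimality of \<open>r\<close>, an annihilating polynomial of degree less than \<open>r\<close> is zero over \<open>W\<close>.\<close>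
  have vanish: "F y = 0" if F: "ann F" "\<And>y i. y \<in> W \<Longrightarrow> i \<ge> r \<Longrightarrow> Polynomial.coeff (F y) i = 0" and y: "y \<in> W" for F y
  proof (rule ccontr)
    assume "F y \<noteq> 0"
    hence "Polynomial.coeff (F y) (Polynomial.degree (F y)) \<noteq> 0" by simp
    hence "r > 0" using F(2)[OF y, of "Polynomial.degree (F y)"] by (cases "r = 0") auto
    have "Polynomial.degree (F z) \<le> r - 1" if "z \<in> W" for z
      by (rule degree_le) (use F(2)[OF that] \<open>r > 0\<close> in auto)
    hence "candidate (r - 1) F" using F(1) y \<open>F y \<noteq> 0\<close> by (auto simp: candidate_def)
    moreover have "r - 1 < r" using \<open>r > 0\<close> by simp
    ultimately show False using not_less_Least[of "r - 1" "\<lambda>n. \<exists>F. candidate n F"] unfolding r_def[symmetric] by blast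
  qed
  have q_ann: "q \<in> poly_family (polyfuns e)" "\<And>x. x \<in> V \<Longrightarrow> poly (q (u x)) (f x) = 0"
    and q_high: "\<And>y i. y \<in> W \<Longrightarrow> i > r \<Longrightarrow> Polynomial.coeff (q y) i = 0"
    using q by (auto simp: candidate_def ann_def intro!: coeff_eq_0 intro: le_less_trans)
  define s where "s = (\<lambda>y. Polynomial.coeff (q y) r)"
  have s: "s \<in> polyfuns e" unfolding s_def by (rule WW.family_coeff[OF q_ann(1)])
  have "\<exists>y0\<in>W. s y0 \<noteq> 0"
  proof (rule ccontr)
    assume "\<not> ?thesis"
    hence "Polynomial.coeff (q y) i = 0" if "y \<in> W" "i \<ge> r" for y i
      using q_high that by (cases "i = r") (auto simp: s_def)
    hence "q y = 0" if "y \<in> W" for y using vanish[of q] q that by (auto simp: candidate_def)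
    thus False using q by (auto simp: candidate_def)
  qed
  then obtain y0 where y0: "y0 \<in> W" "s y0 \<noteq> 0" by blast
  have q_dvd_G: "q y dvd G y" if y: "y \<in> W" "s y \<noteq> 0" for y
  proof -
    have "\<exists>M. \<exists>b\<in>poly_family (polyfuns e). \<exists>rem\<in>poly_family (polyfuns e). \<forall>y\<in>W.
        Polynomial.smult (s y ^ M) (G y) = q y * b y + rem y \<and> (\<forall>i\<ge>r. Polynomial.coeff (rem y) i = 0)"
      unfolding s_def by (rule WW.pseudo_division[OF q_ann(1) _ G(1)]) (erule (1) q_high)
    then obtain M b rem where rem: "rem \<in> poly_family (polyfuns e)"
        and D: "\<forall>y\<in>W. Polynomial.smult (s y ^ M) (G y) = q y * b y + rem y \<and>
          (\<forall>i\<ge>r. Polynomial.coeff (rem y) i = 0)"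
      by (elim exE bexE)
    have D1: "Polynomial.smult (s z ^ M) (G z) = q z * b z + rem z" if "z \<in> W" for z using D that by blast
    have D2: "Polynomial.coeff (rem z) i = 0" if "z \<in> W" "i \<ge> r" for z i using D that by blast
    have "poly (rem (u x)) (f x) = 0" if "x \<in> V" for x
      using arg_cong[OF D1[OF maps_to[OF that]], of "\<lambda>p. poly p (f x)"] G(4)[OF that] q_ann(2)[OF that] by simp
    hence "ann rem" using rem by (simp add: ann_def)
    hence "rem y = 0" using D2 y(1) by (rule vanish)
    hence "q y dvd Polynomial.smult (s y ^ M) (G y)" using D1[OF y(1)] by simp
    thus ?thesis using y(2) by (simp add: dvd_smult_iff)
  qed
  define Y where "Y = {y \<in> W. s y \<noteq> 0}"
  have "\<exists>\<rho>. q y = Polynomial.smult (s y) (\<Prod>l<r. [:- \<rho> l, 1:])" if y: "y \<in> Y" for y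
  proof -
    have deg: "Polynomial.degree (q y) = r"
      using q y by (intro antisym le_degree) (auto simp: candidate_def Y_def s_def)
    let ?p = "Polynomial.smult (inverse (s y)) (q y)"
    have "Polynomial.lead_coeff ?p = 1" "Polynomial.degree ?p = r"
      using y deg by (auto simp: Y_def s_def)
    then obtain \<rho> :: "nat \<Rightarrow> 'k" where "?p = (\<Prod>l<r. [:- \<rho> l, 1:])" by (rule monic_factorization)
    moreover have "q y = Polynomial.smult (s y) ?p" using y by (simp add: Y_def)
    ultimately show ?thesis by metis
  qed
  then obtain \<rho> where \<rho>: "\<And>y. y \<in> Y \<Longrightarrow> q y = Polynomial.smult (s y) (\<Prod>l<r. [:- \<rho> y l, 1:])" by metis
  have \<rho>_root: "poly (G (id y)) (\<rho> y l) = 0" if "y \<in> Y" "l < r" for y l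
  proof -
    have "poly (q y) (\<rho> y l) = 0" unfolding \<rho>[OF that(1)] using that(2) by (auto simp: poly_prod prod_zero_iff)
    moreover have "q y dvd G y" using q_dvd_G that(1) by (simp add: Y_def)
    ultimately show ?thesis by (auto simp: dvd_def)
  qed
  obtain T where T: "finite_extension (polyfuns e) id Y T"
      "\<And>l. l < r \<Longrightarrow> (\<lambda>y. \<rho> y l) \<in> rspan (polyfuns e) id Y T"
    using adjoin_roots[OF WW.fun_algebra_axioms G(1,2,3), of Y r id "\<lambda>l y. \<rho> y l"] \<rho>_root by blast
  interpret M: fun_algebra "rspan (polyfuns e) id Y T" by (rule finite_extension.fun_algebra_span[OF T(1)])
  have "\<exists>b\<in>polyfuns e. \<forall>y\<in>W. Polynomial.coeff (q y) i = s y * b y" for i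
  proof -
    have "(\<lambda>y. \<Prod>l<r. [:- \<rho> y l, 1:]) \<in> poly_family (rspan (polyfuns e) id Y T)"
      by (intro M.family_prod M.family_linear T(2)) auto
    from M.family_coeff[OF this, of i]
    have "(\<lambda>y. Polynomial.coeff (q y) i / s y) \<in> rspan (polyfuns e) id Y T"
      by (rule rspan_cong) (use \<rho> in \<open>auto simp: Y_def\<close>)
    from finite_extension.integral_element[OF T(1) this]
    obtain Q n where Q: "Q \<in> poly_family (polyfuns e)" "\<And>y. Polynomial.lead_coeff (Q y) = 1"
        "\<And>y. Polynomial.degree (Q y) = n" "\<And>y. y \<in> Y \<Longrightarrow> poly (Q (id y)) (Polynomial.coeff (q y) i / s y) = 0"
      by blast
    obtain b where "b \<in> polyfuns e" "\<And>y. y \<in> W \<Longrightarrow> Polynomial.coeff (q y) i = s y * b y"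
      using normal_variety_dvd[OF W normal WW.family_coeff[OF q_ann(1), of i] s y0 Q(1,2,3)] Q(4)
      by (auto simp: Y_def)
    thus ?thesis by blast
  qed
  then obtain b where b: "\<And>i. b i \<in> polyfuns e" "\<And>i y. y \<in> W \<Longrightarrow> Polynomial.coeff (q y) i = s y * b i y" by metis
  define P where "P y = Polynomial.monom 1 r + (\<Sum>i<r. Polynomial.monom (b i y) i)" for y
  have P: "P \<in> poly_family (polyfuns e)"
    unfolding P_def by (intro WW.family_add WW.family_sum WW.family_monom WW.const b)
  have coeff_P: "Polynomial.coeff (P y) i = (if i = r then 1 else if i < r then b i y else 0)" for y i
    by (auto simp: P_def coeff_sum)
  have deg_P: "Polynomial.degree (P y) = r" for y
    by (rule antisym[OF degree_le le_degree]) (simp_all add: coeff_P)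
  have q_P: "q y = Polynomial.smult (s y) (P y)" if "y \<in> W" for y
  proof (rule poly_eqI)
    fix i
    consider "i = r" | "i < r" | "i > r" by linarith
    thus "Polynomial.coeff (q y) i = Polynomial.coeff (Polynomial.smult (s y) (P y)) i"
    proof cases
      case 1
      thus ?thesis by (simp add: coeff_P s_def)
    next
      case 2
      thus ?thesis using b(2)[OF that, of i] by (simp add: coeff_P)
    next
      case 3
      thus ?thesis using q_high[OF that, of i] by (simp add: coeff_P)
    qed
  qed
  have P_root: "poly (P (u x)) (f x) = 0" if x: "x \<in> V" for x
  proof -
    have "\<exists>c\<in>polyfuns d. \<forall>x\<in>V. c x = Polynomial.coeff (P (u x)) i" for i
      using pullback[OF WW.family_coeff[OF P]] .
    then obtain c where c: "\<And>i. c i \<in> polyfuns d" "\<And>i x. x \<in> V \<Longrightarrow> c i x = Polynomial.coeff (P (u x)) i" by metis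
    have eq: "(\<Sum>i\<le>r. c i x * f x ^ i) = poly (P (u x)) (f x)" if "x \<in> V" for x
      using c(2)[OF that] by (simp add: poly_altdef deg_P)
    have "(\<lambda>x. \<Sum>i\<le>r. c i x * f x ^ i) \<in> polyfuns d" by (intro VV.sum VV.mult VV.power c f)
    from pullback_cancel[OF s y0 this _ x] show ?thesis
      using eq x q_ann(2) q_P[OF maps_to] by (auto simp: maps_to)
  qed
  show thesis
  proof (rule that[OF P _ deg_P P_root])
    show "Polynomial.lead_coeff (P y) = 1" for y by (simp add: deg_P coeff_P)
    fix F y assume F: "F \<in> poly_family (polyfuns e)" "\<And>x. x \<in> V \<Longrightarrow> poly (F (u x)) (f x) = 0" and y: "y \<in> W"
    have "\<exists>M. \<exists>c\<in>poly_family (polyfuns e). \<exists>rem\<in>poly_family (polyfuns e). \<forall>y\<in>W.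
        Polynomial.smult (Polynomial.coeff (P y) r ^ M) (F y) = P y * c y + rem y \<and>
        (\<forall>i\<ge>r. Polynomial.coeff (rem y) i = 0)"
      by (rule WW.pseudo_division[OF P _ F(1)]) (simp add: coeff_P)
    then obtain M c rem where rem: "rem \<in> poly_family (polyfuns e)"
        and D: "\<forall>y\<in>W. Polynomial.smult (Polynomial.coeff (P y) r ^ M) (F y) = P y * c y + rem y \<and>
          (\<forall>i\<ge>r. Polynomial.coeff (rem y) i = 0)"
      by (elim exE bexE)
    have D1: "F z = P z * c z + rem z" if "z \<in> W" for z using D that by (simp add: coeff_P)
    have D2: "Polynomial.coeff (rem z) i = 0" if "z \<in> W" "i \<ge> r" for z i using D that by blast
    have "poly (rem (u x)) (f x) = 0" if "x \<in> V" for x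
      using arg_cong[OF D1[OF maps_to[OF that]], of "\<lambda>p. poly p (f x)"] F(2)[OF that] P_root[OF that] by simp
    hence "ann rem" using rem by (simp add: ann_def)
    hence "rem y = 0" using D2 y by (rule vanish)
    thus "P y dvd F y" using D1[OF y] by simp
  qed
qed

section \<open>The number of points in a fibre\<close>

text \<open>The hypothesis says that \<open>(y, t)\<close> lies in the closure of the image of the finite map \<open>(u, f)\<close>.
  By \<open>minimal_polynomial\<close> it holds when \<open>t\<close> is a root of the minimal polynomial of \<open>f\<close> at \<open>y\<close>.\<close>

lemma root_is_value:
  assumes f: "f \<in> polyfuns d" and y: "y \<in> W"
    and dvd: "\<And>F. F \<in> poly_family (polyfuns e) \<Longrightarrow> (\<And>x. x \<in> V \<Longrightarrow> poly (F (u x)) (f x) = 0) \<Longrightarrow> poly (F y) t = 0"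
  obtains x where "x \<in> V" "u x = y" "f x = t"
proof -
  let ?R = "{\<lambda>(z, t). poly (F z) t |F. F \<in> poly_family (polyfuns e :: ((nat \<Rightarrow> 'k) \<Rightarrow> 'k) set)}"
  let ?h = "\<lambda>x. (u x, f x)"
  interpret R: fun_algebra ?R by (rule WW.fun_algebra_family_eval)
  obtain S where S: "finite_extension (polyfuns e) u V S" "polyfuns d \<subseteq> rspan (polyfuns e) u V S"
    using finite_morphism_extension[OF V u] by blast
  have base: "(\<lambda>(z, t). \<rho> z) \<in> ?R" if "\<rho> \<in> polyfuns e" for \<rho>
    by (rule CollectI, rule exI[of _ "\<lambda>z. [:\<rho> z:]"]) (use WW.family_pCons0[OF that] in auto)
  have sub: "\<phi> \<in> rspan ?R ?h V S" if "\<phi> \<in> rspan (polyfuns e) u V S" for \<phi>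
    using that
  proof (induction rule: rspan.induct)
    case (zero \<phi>)
    thus ?case by (rule rspan.zero)
  next
    case (step \<rho> g \<phi> \<psi>)
    show ?case by (rule rspan.step[OF base[OF step.hyps(1)] step.hyps(2) step.IH]) (simp add: step.hyps)
  qed
  have fin: "finite_extension ?R ?h V S"
    using S(1) sub by unfold_locales (auto simp: finite_extension_def finite_extension_axioms_def)
  have coords: "(\<lambda>x. id x i) \<in> rspan ?R ?h V S" if "i < d" for i
    using sub S(2) polyfuns.coord[OF that] by auto
  have closure: "\<rho> (y, t) = 0" if "\<rho> \<in> ?R" "\<And>x. x \<in> V \<Longrightarrow> \<rho> (?h x) = 0" for \<rho>
    using that dvd by auto
  obtain \<xi> where \<xi>0: "\<xi> \<in> affine_space d" and \<xi>: "\<And>b \<rho>. b \<in> polyfuns d \<Longrightarrow> \<rho> \<in> ?R \<Longrightarrow>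
      (\<And>x. x \<in> V \<Longrightarrow> b (id x) = \<rho> (?h x)) \<Longrightarrow> b \<xi> = \<rho> (y, t)"
  proof (rule finite_image_closed[where c = id and D = d and z = "(y, t)", OF fin])
    show "(\<lambda>x. id x i) \<in> rspan ?R ?h V S" if "i < d" for i
      using that by (rule coords)
    show "\<rho> (y, t) = 0" if "\<rho> \<in> ?R" "\<And>x. x \<in> V \<Longrightarrow> \<rho> (?h x) = 0" for \<rho>
      using that by (rule closure)
    fix \<xi> assume \<xi>: "\<xi> \<in> affine_space d" "\<And>b \<rho>. b \<in> polyfuns d \<Longrightarrow> \<rho> \<in> ?R \<Longrightarrow>
        (\<And>x. x \<in> V \<Longrightarrow> b (id x) = \<rho> (?h x)) \<Longrightarrow> b \<xi> = \<rho> (y, t)"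
    show thesis
    proof (rule that[OF \<xi>(1)])
      fix b \<rho> assume "b \<in> polyfuns d" "\<rho> \<in> ?R" and eq: "\<And>x. x \<in> V \<Longrightarrow> b (id x) = \<rho> (?h x)"
      thus "b \<xi> = \<rho> (y, t)" by (rule \<xi>(2)) (simp add: eq)
    qed
  qed
  obtain Z where Z: "Z \<subseteq> polyfuns d" "V = zero_locus d Z" using irreducible_affine_varietyD(3)[OF V] by blast
  have "b \<xi> = 0" if "b \<in> Z" for b
    by (rule \<xi>[of b "\<lambda>_. 0"]) (use that Z R.const in \<open>auto simp: zero_locus_def\<close>)
  hence V\<xi>: "\<xi> \<in> V" using \<xi>0 Z(2) by (simp add: zero_locus_def)
  show thesis
  proof
    show "\<xi> \<in> V" by (rule V\<xi>)
    have "(\<lambda>(z, t). t) \<in> ?R"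
      by (rule CollectI, rule exI[of _ "\<lambda>_. [:0, 1:]"]) (auto intro: WW.family_const)
    from \<xi>[OF f this] show "f \<xi> = t" by simp
    have "u \<xi> i = y i" if i: "i < e" for i
    proof -
      obtain b where b: "b \<in> polyfuns d" "\<And>x. x \<in> V \<Longrightarrow> b x = u x i" using coordinate_pullback[OF i] by blast
      have "b \<xi> = (\<lambda>(z, t). z i) (y, t)"
        by (rule \<xi>[OF b(1) base[OF polyfuns.coord[OF i]]]) (simp add: b(2))
      thus ?thesis using b(2)[OF V\<xi>] by simp
    qed
    moreover have "u \<xi> \<in> affine_space e" "y \<in> affine_space e"
      using irreducible_affine_varietyD(2)[OF W] maps_to[OF V\<xi>] y by auto
    ultimately show "u \<xi> = y" unfolding affine_space_def by (intro PiE_ext) auto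
  qed
qed

text \<open>The points of \<open>W\<close> whose fibre has at least \<open>m\<close> points. The subset \<open>F\<close> makes this meaningful
  without knowing that fibres are finite.\<close>

definition at_least :: "nat \<Rightarrow> (nat \<Rightarrow> 'k) set" where
  "at_least m = {y \<in> W. \<exists>F \<subseteq> {x \<in> V. u x = y}. finite F \<and> card F = m}"

lemma at_least_neighbourhood:
  assumes "y0 \<in> at_least m"
  shows "\<exists>s\<in>polyfuns e. s y0 \<noteq> 0 \<and> (\<forall>y\<in>W. s y \<noteq> 0 \<longrightarrow> y \<in> at_least m)"
proof -
  obtain F where y0: "y0 \<in> W" and F: "F \<subseteq> {x \<in> V. u x = y0}" "finite F" "card F = m"
    using assms by (auto simp: at_least_def)
  have "F \<subseteq> affine_space d" using F(1) irreducible_affine_varietyD(2)[OF V] by blast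
  then obtain f where f: "f \<in> polyfuns d" "inj_on f F" using separating_polyfun[OF F(2)] by blast
  obtain P r where P: "P \<in> poly_family (polyfuns e)" "\<And>y. Polynomial.lead_coeff (P y) = 1"
      "\<And>y. Polynomial.degree (P y) = r" "\<And>x. x \<in> V \<Longrightarrow> poly (P (u x)) (f x) = 0"
      "\<And>F y. F \<in> poly_family (polyfuns e) \<Longrightarrow> (\<And>x. x \<in> V \<Longrightarrow> poly (F (u x)) (f x) = 0) \<Longrightarrow> y \<in> W \<Longrightarrow> P y dvd F y"
    using minimal_polynomial[OF f(1)] by metis
  have fin: "finite {c. poly (P y) c = 0}" for y
    using P(2)[of y] by (intro poly_roots_finite) auto
  have "f ` F \<subseteq> {c. poly (P y0) c = 0}" using F(1) P(4) by auto
  hence "m \<le> card {c. poly (P y0) c = 0}"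
    using card_mono[OF fin] card_image[OF f(2)] F(3) by metis
  then obtain s where s: "s \<in> polyfuns e" "s y0 \<noteq> 0"
      "\<And>y. y \<in> W \<Longrightarrow> s y \<noteq> 0 \<Longrightarrow> card {c. poly (P y) c = 0} \<ge> m"
    using many_roots_open[OF P(1-3)] by blast
  show ?thesis
  proof (rule bexI[OF _ s(1)], intro conjI ballI impI s(2))
    fix y assume y: "y \<in> W" "s y \<noteq> 0"
    obtain C where C: "C \<subseteq> {c. poly (P y) c = 0}" "card C = m" "finite C"
      using obtain_subset_with_card_n[OF s(3)[OF y]] fin finite_subset by metis
    have "\<exists>x. x \<in> V \<and> u x = y \<and> f x = c" if "c \<in> C" for c
    proof (rule root_is_value[OF f(1) y(1)])
      show "poly (F y) c = 0" if "F \<in> poly_family (polyfuns e)" "\<And>x. x \<in> V \<Longrightarrow> poly (F (u x)) (f x) = 0" for F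
        using P(5)[OF that y(1)] C(1) \<open>c \<in> C\<close> by (auto simp: dvd_def)
    qed blast
    then obtain x where x: "\<And>c. c \<in> C \<Longrightarrow> x c \<in> V \<and> u (x c) = y \<and> f (x c) = c" by metis
    have "inj_on x C" by (rule inj_onI) (metis x)
    thus "y \<in> at_least m"
      unfolding at_least_def using y(1) x C by (auto intro!: exI[of _ "x ` C"] simp: card_image)
  qed
qed

lemma openin_at_least: "openin (subtopology (zariski e) W) (at_least m)"
proof -
  define Z where "Z = {s \<in> polyfuns e. \<forall>y\<in>W. s y \<noteq> 0 \<longrightarrow> y \<in> at_least m}"
  have "at_least m = (affine_space e - zero_locus e Z) \<inter> W"
  proof (intro equalityI subsetI)
    fix y assume y: "y \<in> at_least m"
    hence "y \<in> W" by (simp add: at_least_def)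
    moreover from at_least_neighbourhood[OF y] obtain s where "s \<in> Z" "s y \<noteq> 0"
      by (auto simp: Z_def)
    ultimately show "y \<in> (affine_space e - zero_locus e Z) \<inter> W"
      using irreducible_affine_varietyD(2)[OF W] by (auto simp: zero_locus_def)
  next
    fix y assume "y \<in> (affine_space e - zero_locus e Z) \<inter> W"
    thus "y \<in> at_least m" by (auto simp: zero_locus_def Z_def)
  qed
  moreover have "openin (zariski e) (affine_space e - zero_locus e Z)"
    unfolding openin_zariski by (rule exI[of _ Z]) (auto simp: Z_def)
  ultimately show ?thesis unfolding openin_subtopology by blast
qed

text \<open>For \<open>m = 0\<close> one would have to know that fibres are finite, as an infinite set has cardinality
  \<open>0\<close>.\<close>

lemma fibre_card_eq:
  assumes "1 \<le> m"
  shows "{y \<in> W. card {x \<in> V. u x = y} = m} = at_least m - at_least (Suc m)"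
proof (intro equalityI subsetI)
  fix y assume y: "y \<in> {y \<in> W. card {x \<in> V. u x = y} = m}"
  hence yW: "y \<in> W" and card: "card {x \<in> V. u x = y} = m" by auto
  have fin: "finite {x \<in> V. u x = y}" by (rule card_ge_0_finite) (use card assms in simp)
  have "y \<in> at_least m"
    unfolding at_least_def using yW card fin by blast
  moreover have "card F \<noteq> Suc m" if "F \<subseteq> {x \<in> V. u x = y}" for F
    using card_mono[OF fin that] card by simp
  hence "y \<notin> at_least (Suc m)" unfolding at_least_def by blast
  ultimately show "y \<in> at_least m - at_least (Suc m)" by blast
next
  fix y assume y: "y \<in> at_least m - at_least (Suc m)"
  let ?X = "{x \<in> V. u x = y}"
  obtain F where F: "y \<in> W" "F \<subseteq> ?X" "finite F" "card F = m" using y by (auto simp: at_least_def)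
  have "F = ?X"
  proof (rule ccontr)
    assume "F \<noteq> ?X"
    then obtain x where x: "x \<in> ?X" "x \<notin> F" using F(2) by blast
    hence "insert x F \<subseteq> ?X" "finite (insert x F)" "card (insert x F) = Suc m" using F by auto
    hence "y \<in> at_least (Suc m)" unfolding at_least_def using F(1) by blast
    thus False using y by simp
  qed
  thus "y \<in> {y \<in> W. card {x \<in> V. u x = y} = m}" using F by auto
qed

end

theorem corollary1:
  fixes V W :: "(nat \<Rightarrow> 'k::alg_closed_field) set"
    and u :: "(nat \<Rightarrow> 'k) \<Rightarrow> (nat \<Rightarrow> 'k)"
    and d e n m :: nat
  assumes "irreducible_affine_variety d V"
    and "irreducible_affine_variety e W"
    and "variety_morphism d V e W u"
    and "finite_morphism d V e W u"
    and "dominant V e W u"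
    and "n = separable_degree (function_field d V) (embedded_function_field d V e W u)"
    and "normal_variety e W"
    and "1 \<le> m" and "m \<le> n"
  shows "locally_closedin (subtopology (zariski e) W) {y \<in> W. card {x \<in> V. u x = y} = m}"
proof -
  interpret finite_normal_cover V W u d e
    using assms by unfold_locales
  let ?T = "subtopology (zariski e) W"
  have "openin ?T (at_least m)" "closedin ?T (topspace ?T - at_least (Suc m))"
    by (rule openin_at_least, rule closedin_diff[OF closedin_topspace openin_at_least])
  moreover have "{y \<in> W. card {x \<in> V. u x = y} = m} = at_least m \<inter> (topspace ?T - at_least (Suc m))"
    using openin_subset[OF openin_at_least[of m]] fibre_card_eq[OF \<open>1 \<le> m\<close>] by blast
  ultimately show ?thesis unfolding locally_closedin_def by blast
qed

end
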